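(* Let $r\ge0$ be an integer and let $M = \begin{pmatrix} A & B \\ J & A^{\dagger}\end{pmatrix}$ be the $(2r+2)\times(2r+2)$ $0,1$-matrix defined in the context. Then for every pair of elements $x<y$ of the level poset associated to $M$, the order complex of the interval $[x,y]$ is homeomorphic to a sphere.
   Context: Blocks (all $(r+1)\times(r+1)$, indexed by $0\le i,j\le r$): $A=(a_{i,j})$ with $a_{i,j}=1$ if $i=0$ and $0$ otherwise; $B=(b_{i,j})$ with $b_{i,j}=1$ if $0\le i-j\le 1$ and $0$ otherwise; $J$ is the all-ones matrix; $A^{\dagger}$ has $(A^{\dagger})_{i,j}=1$ if $j=r$ and $0$ otherwise. Rows and columns of $M$ are indexed by $0,\ldots,2r+1$. The level poset associated to a $0,1$-matrix $X=(x_{i,j})$ is the ranked poset on (index set) $\times\mathbb{Z}$ with cover relations $(i,s)\prec(j,s+1)$ iff $x_{i,j}=1$. The order complex of an interval $[x,y]$ is the simplicial complex whose faces are the chains of the open interval $\{z: x<z<y\}$. The empty complex (arising when $y$ covers $x$) is regarded as the $(-1)$-dimensional sphere. *)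

theory Defs
  imports "HOL-Analysis.Analysis" "Jordan_Normal_Form.Matrix"
begin

definition block_A :: "nat \<Rightarrow> nat mat" where
  "block_A r = mat (r + 1) (r + 1) (\<lambda>(i, j). if i = 0 then 1 else 0)"

definition block_B :: "nat \<Rightarrow> nat mat" where
  "block_B r = mat (r + 1) (r + 1)
     (\<lambda>(i, j). if 0 \<le> int i - int j \<and> int i - int j \<le> 1 then 1 else 0)"

definition block_J :: "nat \<Rightarrow> nat mat" where
  "block_J r = mat (r + 1) (r + 1) (\<lambda>(i, j). 1)"

definition block_A_dagger :: "nat \<Rightarrow> nat mat" where
  "block_A_dagger r = mat (r + 1) (r + 1) (\<lambda>(i, j). if j = r then 1 else 0)"

definition matrix_M :: "nat \<Rightarrow> nat mat" where
  "matrix_M r = four_block_mat (block_A r) (block_B r) (block_J r) (block_A_dagger r)"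

text \<open>The matrix \<open>X\<close> below is meant to be a square 0,1-matrix, so that rows and columns share
  the index set \<open>{..<dim_row X}\<close>.\<close>

definition level_elements :: "nat mat \<Rightarrow> (nat \<times> int) set" where
  "level_elements X = {..<dim_row X} \<times> UNIV"

definition level_covers :: "nat mat \<Rightarrow> (nat \<times> int) rel" where
  "level_covers X =
     {((i, s), (j, s + 1)) | i j s. i < dim_row X \<and> j < dim_row X \<and> X $$ (i, j) = 1}"

definition level_order :: "nat mat \<Rightarrow> (nat \<times> int) rel" where
  "level_order X = Restr ((level_covers X)\<^sup>*) (level_elements X)"

lemma level_covers_rtrancl:
  assumes "(x, y) \<in> (level_covers X)\<^sup>*"
  shows "x = y \<or> snd x < snd y"
  using assms by (induction rule: rtrancl_induct) (auto simp: level_covers_def)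

lemma partial_order_level_order: "partial_order_on (level_elements X) (level_order X)"
proof -
  have "antisym (level_order X)"
    unfolding antisym_def level_order_def
    by (metis IntD1 level_covers_rtrancl order_less_asym)
  moreover have "trans (level_order X)"
    unfolding level_order_def by (rule trans_Restr[OF trans_rtrancl])
  ultimately show ?thesis
    by (auto simp: partial_order_on_def preorder_on_def refl_on_def level_order_def)
qed

text \<open>The open interval between \<open>x\<close> and \<open>y\<close> is \<open>aboveS R x \<inter> underS R y\<close>. The empty chain is a
  face, so the empty complex is \<open>{{}}\<close>.\<close>

definition order_complex :: "'a rel \<Rightarrow> 'a \<Rightarrow> 'a \<Rightarrow> 'a set set" where
  "order_complex R x y = {C \<in> Chains R. finite C \<and> C \<subseteq> aboveS R x \<inter> underS R y}"

text \<open>Points of the geometric realization are given by barycentric coordinates whose support is a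
  face. For complexes with finitely many vertices (such as the order complexes of intervals of a
  level poset) the topology of pointwise convergence used here is the usual one; for infinite
  complexes it may be coarser than the weak topology.\<close>

definition geometric_realization :: "'a set set \<Rightarrow> ('a \<Rightarrow> real) topology" where
  "geometric_realization K = subtopology (powertop_real UNIV)
     {f. (\<forall>v. 0 \<le> f v) \<and> {v. f v \<noteq> 0} \<in> K \<and> (\<Sum>v | f v \<noteq> 0. f v) = 1}"

text \<open>The empty space is the sphere of dimension -1; the library's \<open>nsphere n\<close> is the sphere of
  dimension \<open>n \<ge> 0\<close>.\<close>

definition homeomorphic_to_sphere :: "'a topology \<Rightarrow> bool" where
  "homeomorphic_to_sphere T \<longleftrightarrow> topspace T = {} \<or> (\<exists>n. T homeomorphic_space nsphere n)"

end

theory Submission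
  imports Defs
begin

text \<open>
  The order complex of an open interval is realized as a complete simplicial fan: every vertex
  gets a vector so that each vector of the ambient space is, in exactly one way, a nonnegative
  combination of the vectors along a chain. Normalizing these combinations is then a homeomorphism
  onto a sphere.

  Suppose that every level above the bottom \<open>b\<close> of the interval is full. Let \<open>e k\<close> be the unit
  vector belonging to level \<open>k\<close>. In the plane of \<open>e m\<close> and \<open>e (m + 1)\<close> consider the rays
  \<open>R 0 = (-1, 0)\<close>, \<open>R j = (2 * j, 1)\<close> for \<open>1 \<le> j \<le> r\<close>, and \<open>R (r + 1) = (1, 0)\<close>. The vertex
  \<open>(j, m)\<close> with \<open>j \<le> r\<close> gets the direction \<open>R j\<close>, and \<open>(r + 1 + j, m + 1)\<close> gets \<open>(2 * j + 1, 1)\<close>,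
  which lies between \<open>R j\<close> and \<open>R (j + 1)\<close>. The open cells are then cut out by
  the last nonzero coordinate: it is negative, or the preceding coordinate
  divided by it either equals some \<open>2 * j\<close> or lies between two consecutive such values. When the
  bottom element is \<open>(i, s)\<close> with \<open>1 \<le> i \<le> r\<close>, level \<open>s + 1\<close> of the interval consists of two vertices
  below everything else, and the complex is a suspension of the previous case.
\<close>

section \<open>Complete fans and spheres\<close>

text \<open>Vectors are total functions compared only on \<open>I\<close>, so the space with
  coordinate set \<open>I\<close> needs no type of its own.\<close>

definition fan_rep :: "'a set set \<Rightarrow> ('a \<Rightarrow> 'i \<Rightarrow> real) \<Rightarrow> 'i set \<Rightarrow> ('i \<Rightarrow> real) \<Rightarrow> ('a \<Rightarrow> real) \<Rightarrow> bool" where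
  "fan_rep K p I u f \<longleftrightarrow>
     (\<forall>v. 0 \<le> f v) \<and> {v. f v \<noteq> 0} \<in> K \<and> (\<forall>i\<in>I. (\<Sum>v | f v \<noteq> 0. f v * p v i) = u i)"

definition complete_fan :: "'a set set \<Rightarrow> ('a \<Rightarrow> 'i \<Rightarrow> real) \<Rightarrow> 'i set \<Rightarrow> bool" where
  "complete_fan K p I \<longleftrightarrow> (\<forall>u. \<exists>!f. fan_rep K p I u f)"

lemma fan_rep_scale:
  assumes "fan_rep K p I u f" "c > 0"
  shows "fan_rep K p I (\<lambda>i. c * u i) (\<lambda>v. c * f v)"
  using assms by (auto simp: fan_rep_def mult.assoc simp flip: sum_distrib_left)

text \<open>A representation of zero stays one after doubling, so uniqueness forces \<open>f\<close>
  to equal twice itself.\<close>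

lemma complete_fan_zero:
  assumes "complete_fan K p I" "fan_rep K p I u f" "\<And>i. i \<in> I \<Longrightarrow> u i = 0"
  shows "f = (\<lambda>v. 0)"
proof -
  have *: "fan_rep K p I u (\<lambda>v. 2 * f v)"
    using fan_rep_scale[OF assms(2), of 2] assms(3) by (auto simp: fan_rep_def)
  have "f = (\<lambda>v. 2 * f v)"
    using assms(1,2) * unfolding complete_fan_def by blast
  then show ?thesis by (metis (full_types) mult_2 add_cancel_right_right)
qed

text \<open>The realization is a finite union of closed simplices, each a closed subset of a product
  of compact intervals and points, which is compact by Tychonoff.\<close>

lemma compact_geometric_realization:
  fixes K :: "'a set set"
  assumes "finite K" "\<And>F. F \<in> K \<Longrightarrow> finite F" "\<And>F G. F \<in> K \<Longrightarrow> G \<subseteq> F \<Longrightarrow> G \<in> K"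
  shows "compact_space (geometric_realization K)"
proof -
  define S where "S F = {f::'a \<Rightarrow> real. (\<forall>v. f v \<in> (if v \<in> F then {0..1} else {0})) \<and> (\<Sum>v\<in>F. f v) = 1}" for F
  have "{f. (\<forall>v. 0 \<le> f v) \<and> {v. f v \<noteq> 0} \<in> K \<and> (\<Sum>v | f v \<noteq> 0. f v) = 1} = \<Union>(S ` K)"
    (is "?L = ?R")
  proof (intro equalityI subsetI)
    fix f assume f: "f \<in> ?L"
    then have "finite {v. f v \<noteq> 0}" using assms(2) by blast
    then have "f v \<le> 1" if "f v \<noteq> 0" for v
      using member_le_sum[of v "{v. f v \<noteq> 0}" f] f that by auto
    then have "f \<in> S {v. f v \<noteq> 0}" using f by (auto simp: S_def)
    then show "f \<in> ?R" using f by blast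
  next
    fix f assume "f \<in> ?R"
    then obtain F where F: "F \<in> K" "f \<in> S F" by blast
    then have sub: "{v. f v \<noteq> 0} \<subseteq> F" and nn: "\<forall>v. 0 \<le> f v"
      by (auto simp: S_def split: if_splits)
    have "(\<Sum>v | f v \<noteq> 0. f v) = (\<Sum>v\<in>F. f v)"
      using sub assms(2)[OF F(1)] by (intro sum.mono_neutral_left) auto
    then show "f \<in> ?L" using nn sub F assms(3) by (auto simp: S_def)
  qed
  moreover have "compactin (powertop_real UNIV) (S F)" if "F \<in> K" for F
  proof (rule closed_compactin)
    show "compactin (powertop_real UNIV) (PiE UNIV (\<lambda>v. if v \<in> F then {0..1} else {0::real}))"
      by (auto simp: compactin_PiE)
    show "S F \<subseteq> PiE UNIV (\<lambda>v. if v \<in> F then {0..1} else {0::real})"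
      by (auto simp: S_def PiE_def Pi_def)
    have "continuous_map (powertop_real UNIV) euclideanreal (\<lambda>f. \<Sum>v\<in>F. f v)"
      using assms(2)[OF that]
      by (intro continuous_map_sum continuous_map_product_projection) auto
    then have c1: "closedin (powertop_real UNIV)
        {f \<in> topspace (powertop_real UNIV). (\<Sum>v\<in>F. f v) \<in> {1}}"
      by (intro closedin_continuous_map_preimage) auto
    have c2: "closedin (powertop_real UNIV) (PiE UNIV (\<lambda>v. if v \<in> F then {0..1} else {0::real}))"
      by (auto simp: closedin_product_topology)
    have eq: "S F = {f \<in> topspace (powertop_real UNIV). (\<Sum>v\<in>F. f v) \<in> {1}} \<inter>
        PiE UNIV (\<lambda>v. if v \<in> F then {0..1} else {0::real})"
      by (auto simp: S_def PiE_def Pi_def)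
    show "closedin (powertop_real UNIV) (S F)" unfolding eq using c1 c2 by (rule closedin_Int)
  qed
  ultimately have "compactin (powertop_real UNIV)
      {f. (\<forall>v. 0 \<le> f v) \<and> {v. f v \<noteq> 0} \<in> K \<and> (\<Sum>v | f v \<noteq> 0. f v) = 1}"
    using assms(1) by (auto intro!: compactin_Union)
  then show ?thesis
    unfolding geometric_realization_def by (rule compact_space_subtopology)
qed

text \<open>The homeomorphism sends a point of the realization to the normalized vector it represents.\<close>

lemma complete_fan_sphere:
  fixes K :: "'a set set" and p :: "'a \<Rightarrow> 'i \<Rightarrow> real"
  assumes fan: "complete_fan K p I" and I: "finite I"
    and K: "finite K" "\<And>F. F \<in> K \<Longrightarrow> finite F" "\<And>F G. F \<in> K \<Longrightarrow> G \<subseteq> F \<Longrightarrow> G \<in> K"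
  shows "homeomorphic_to_sphere (geometric_realization K)"
proof (cases "I = {}")
  case True
  \<comment> \<open>With no coordinates to test, every point represents zero and hence is zero,
    against total mass 1. The realization is the empty sphere.\<close>
  have "f \<notin> topspace (geometric_realization K)" for f
  proof
    assume f: "f \<in> topspace (geometric_realization K)"
    then have "fan_rep K p I (\<lambda>i. 0) f"
      using True by (auto simp: geometric_realization_def fan_rep_def)
    then have "f = (\<lambda>v. 0)" by (rule complete_fan_zero[OF fan]) auto
    with f show False by (auto simp: geometric_realization_def)
  qed
  then have "topspace (geometric_realization K) = {}" by blast
  then show ?thesis unfolding homeomorphic_to_sphere_def ..
next
  case False
  define n where "n = card I - 1"
  have cI: "card I = Suc n" using False I by (simp add: n_def card_gt_0_iff)
  obtain g where g: "bij_betw g {..n} I"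
    using ex_bij_betw_nat_finite[OF I] cI by (metis atLeast0LessThan lessThan_Suc_atMost)
  \<comment> \<open>Summing over the fixed finite set of all vertices, instead of the support of
    \<open>f\<close>, makes the represented vector visibly continuous in \<open>f\<close>.\<close>
  define V where "V = \<Union>K"
  have finV: "finite V" using K by (auto simp: V_def)
  define W where "W f i = (\<Sum>v\<in>V. f v * p v i)" for f i
  define N where "N f = sqrt (\<Sum>k\<le>n. (W f (g k))\<^sup>2)" for f
  define \<Phi> where "\<Phi> f k = (if k \<le> n then W f (g k) / N f else 0)" for f k
  let ?X = "geometric_realization K"
  have topX: "topspace ?X = {f. (\<forall>v. 0 \<le> f v) \<and> {v. f v \<noteq> 0} \<in> K \<and> (\<Sum>v | f v \<noteq> 0. f v) = 1}"
    by (simp add: geometric_realization_def)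
  have rep: "fan_rep K p I u f \<longleftrightarrow> (\<forall>v. 0 \<le> f v) \<and> {v. f v \<noteq> 0} \<in> K \<and> (\<forall>i\<in>I. W f i = u i)" for u f
  proof -
    have "(\<Sum>v | f v \<noteq> 0. f v * p v i) = W f i" if "{v. f v \<noteq> 0} \<in> K" for i
      unfolding W_def using finV that by (intro sum.mono_neutral_left) (auto simp: V_def)
    then show ?thesis by (auto simp: fan_rep_def)
  qed
  have Npos: "N f > 0" if f: "f \<in> topspace ?X" for f
  proof -
    have fr: "fan_rep K p I (W f) f" using f by (auto simp: rep topX)
    have "\<exists>i\<in>I. W f i \<noteq> 0"
    proof (rule ccontr)
      assume "\<not> ?thesis"
      then have "f = (\<lambda>v. 0)" by (intro complete_fan_zero[OF fan fr]) auto
      with f show False by (auto simp: topX)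
    qed
    then obtain k where "k \<le> n" "W f (g k) \<noteq> 0" using g by (auto simp: bij_betw_def)
    then have "(\<Sum>k\<le>n. (W f (g k))\<^sup>2) > 0"
      by (intro sum_pos2[of _ k]) auto
    then show ?thesis by (simp add: N_def)
  qed
  have contp: "continuous_map ?X euclideanreal (\<lambda>f. W f i)" for i
    unfolding W_def geometric_realization_def using finV
    by (intro continuous_map_sum continuous_map_real_mult continuous_map_const[THEN iffD2]
        continuous_map_from_subtopology continuous_map_product_projection) auto
  have contN: "continuous_map ?X euclideanreal N"
    unfolding N_def
    by (intro continuous_map_sqrt continuous_map_sum continuous_map_real_pow contp) auto
  have cont: "continuous_map ?X (powertop_real UNIV) \<Phi>"
    unfolding continuous_map_componentwise_UNIV
  proof
    fix k show "continuous_map ?X euclideanreal (\<lambda>f. \<Phi> f k)"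
      unfolding \<Phi>_def
      by (cases "k \<le> n") (auto intro!: continuous_map_real_divide contp contN dest: Npos)
  qed
  have tops: "topspace (nsphere n) = {x. (\<Sum>i\<le>n. (x i)\<^sup>2) = 1 \<and> (\<forall>i>n. x i = 0)}"
    by (simp add: nsphere)
  have into: "\<Phi> f \<in> topspace (nsphere n)" if f: "f \<in> topspace ?X" for f
  proof -
    have "(\<Sum>i\<le>n. (\<Phi> f i)\<^sup>2) = (\<Sum>i\<le>n. (W f (g i))\<^sup>2) / (N f)\<^sup>2"
      by (simp add: \<Phi>_def power_divide sum_divide_distrib)
    also have "(N f)\<^sup>2 = (\<Sum>i\<le>n. (W f (g i))\<^sup>2)" by (simp add: N_def sum_nonneg)
    finally show ?thesis using Npos[OF f] \<open>(N f)\<^sup>2 = _\<close> by (auto simp: tops \<Phi>_def)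
  qed
  have inj: "inj_on \<Phi> (topspace ?X)"
  proof (rule inj_onI)
    fix f f' assume f: "f \<in> topspace ?X" and f': "f' \<in> topspace ?X" and eq: "\<Phi> f = \<Phi> f'"
    \<comment> \<open>Vectors of equal direction differ by the factor \<open>c\<close>, so
      \<open>f\<close> and \<open>c * f'\<close> represent the same vector and agree by uniqueness;
      comparing total masses gives \<open>c = 1\<close>.\<close>
    define c where "c = N f / N f'"
    have c: "c > 0" using Npos f f' by (simp add: c_def)
    have W: "W f i = c * W f' i" if i: "i \<in> I" for i
    proof -
      obtain k where k: "k \<le> n" "i = g k" using g i by (auto simp: bij_betw_def)
      then show ?thesis using fun_cong[OF eq, of k] Npos[OF f] Npos[OF f']
        by (simp add: \<Phi>_def c_def field_simps)
    qed
    have "fan_rep K p I (\<lambda>i. c * W f' i) (\<lambda>v. c * f' v)"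
      using f' by (intro fan_rep_scale c) (auto simp: rep topX)
    moreover have "fan_rep K p I (\<lambda>i. c * W f' i) f"
      using f W by (auto simp: rep topX)
    ultimately have ff: "f = (\<lambda>v. c * f' v)"
      using fan unfolding complete_fan_def by blast
    have "{v. f v \<noteq> 0} = {v. f' v \<noteq> 0}" using c by (subst ff) auto
    then have "(\<Sum>v | f v \<noteq> 0. f v) = c * (\<Sum>v | f' v \<noteq> 0. f' v)"
      by (subst ff) (simp add: sum_distrib_left)
    then have "c = 1" using f f' by (simp add: topX)
    then show "f = f'" using ff by simp
  qed
  have surj: "\<exists>f\<in>topspace ?X. \<Phi> f = x" if x: "x \<in> topspace (nsphere n)" for x
  proof -
    define u where "u i = x (inv_into {..n} g i)" for i
    have u: "u (g k) = x k" if "k \<le> n" for k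
      using that g by (simp add: u_def bij_betw_def)
    obtain f where f: "fan_rep K p I u f" using fan unfolding complete_fan_def by blast
    have "f \<noteq> (\<lambda>v. 0)"
    proof
      assume "f = (\<lambda>v. 0)"
      then have "\<forall>i\<in>I. u i = 0" using f by (auto simp: fan_rep_def)
      then have "\<forall>k\<le>n. x k = 0" using u g by (metis atMost_iff bij_betwE)
      then show False using x by (simp add: tops)
    qed
    then obtain v0 where v0: "f v0 \<noteq> 0" by auto
    \<comment> \<open>Dividing by the total mass \<open>s\<close> moves \<open>f\<close> along its
      ray to a point of the realization.\<close>
    define s where "s = (\<Sum>v | f v \<noteq> 0. f v)"
    have "finite {v. f v \<noteq> 0}" using f K by (auto simp: fan_rep_def)
    then have s: "s > 0" unfolding s_def
      using f v0 by (intro sum_pos2[of _ v0]) (auto simp: fan_rep_def less_le)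
    define h where "h v = (1/s) * f v" for v
    have h: "fan_rep K p I (\<lambda>i. (1/s) * u i) h"
      unfolding h_def using s by (intro fan_rep_scale f) auto
    have "{v. h v \<noteq> 0} = {v. f v \<noteq> 0}" using s by (auto simp: h_def)
    then have "(\<Sum>v | h v \<noteq> 0. h v) = 1"
      using s by (simp add: h_def s_def flip: sum_divide_distrib)
    then have hX: "h \<in> topspace ?X" using h by (auto simp: topX fan_rep_def)
    have Wh: "W h (g k) = x k / s" if "k \<le> n" for k
      using h that g u by (auto simp: rep bij_betw_def)
    have "(\<Sum>k\<le>n. (W h (g k))\<^sup>2) = (\<Sum>k\<le>n. (x k)\<^sup>2) / s\<^sup>2"
      by (simp add: Wh power_divide sum_divide_distrib)
    then have "N h = 1 / s" using x s by (simp add: N_def tops real_sqrt_divide)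
    then have "\<Phi> h = x" using x s by (auto simp: \<Phi>_def Wh tops)
    then show ?thesis using hX by blast
  qed
  \<comment> \<open>A continuous bijection from a compact space onto a Hausdorff space is a
    homeomorphism.\<close>
  have "homeomorphic_map ?X (nsphere n) \<Phi>"
  proof (rule continuous_imp_homeomorphic_map)
    show "compact_space ?X" using K by (rule compact_geometric_realization)
    show "Hausdorff_space (nsphere n)"
      unfolding nsphere by (intro Hausdorff_space_subtopology) (simp add: Hausdorff_space_product_topology)
    show "continuous_map ?X (nsphere n) \<Phi>"
      using cont into by (simp add: nsphere continuous_map_in_subtopology image_subset_iff)
    show "\<Phi> ` topspace ?X = topspace (nsphere n)" using into surj by blast
  qed (rule inj)
  from homeomorphic_map_imp_homeomorphic_space[OF this] show ?thesis
    unfolding homeomorphic_to_sphere_def by (rule disjI2[OF exI])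
qed

section \<open>The order of the level poset\<close>

text \<open>The three cases are the row types of \<open>matrix_M\<close>: the row of ones of
  \<open>block_A\<close> with the first row of \<open>block_B\<close>, a zero row of
  \<open>block_A\<close> with a later row of \<open>block_B\<close>, and a row of
  \<open>block_J\<close> with one of \<open>block_A_dagger\<close>.\<close>

definition edge :: "nat \<Rightarrow> nat \<Rightarrow> nat \<Rightarrow> bool" where
  "edge r i j \<longleftrightarrow> i \<le> 2 * r + 1 \<and> j \<le> 2 * r + 1 \<and>
     (if i = 0 then j \<le> r + 1
      else if i \<le> r then j = r + i \<or> j = r + i + 1
      else j \<le> r \<or> j = 2 * r + 1)"

lemma dim_matrix_M [simp]: "dim_row (matrix_M r) = 2 * r + 2"
  by (simp add: matrix_M_def block_A_def block_A_dagger_def)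

lemma matrix_M_edge:
  assumes "i < 2 * r + 2" "j < 2 * r + 2"
  shows "matrix_M r $$ (i, j) = 1 \<longleftrightarrow> edge r i j"
proof -
  have "matrix_M r $$ (i, j) =
    (if i < r + 1 then if j < r + 1 then block_A r $$ (i, j) else block_B r $$ (i, j - (r + 1))
     else if j < r + 1 then block_J r $$ (i - (r + 1), j)
     else block_A_dagger r $$ (i - (r + 1), j - (r + 1)))"
    using assms unfolding matrix_M_def
    by (subst index_mat_four_block)
       (auto simp: block_A_def block_B_def block_J_def block_A_dagger_def)
  then show ?thesis
    using assms
    by (auto simp: edge_def block_A_def block_B_def block_J_def block_A_dagger_def)
qed

text \<open>Two levels up, only a vertex with \<open>1 \<le> i \<le> r\<close> fails to reach everything; three levels up,
  every vertex is reached.\<close>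

definition below :: "nat \<Rightarrow> nat \<times> int \<Rightarrow> nat \<times> int \<Rightarrow> bool" where
  "below r x y \<longleftrightarrow> fst x \<le> 2 * r + 1 \<and> fst y \<le> 2 * r + 1 \<and>
     (snd y = snd x + 1 \<and> edge r (fst x) (fst y) \<or>
      snd y = snd x + 2 \<and> (fst x = 0 \<or> fst x > r \<or> fst y \<le> r \<or> fst y = 2 * r + 1) \<or>
      snd y \<ge> snd x + 3)"

lemma below_step:
  assumes "below r x (j, u)" "edge r j k"
  shows "below r x (k, u + 1)"
  using assms by (auto simp: below_def edge_def split: if_splits)

text \<open>If \<open>1 \<le> i \<le> r\<close> and the gap is two, the middle vertex must be a
  successor of \<open>i\<close>, and \<open>r + i\<close> works. Otherwise every \<open>k\<close>
  has a predecessor of index at most \<open>r\<close>, and all such vertices are already reached one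
  level lower.\<close>

lemma below_pred:
  assumes "below r x (k, u)" "u \<ge> snd x + 2"
  shows "\<exists>j. below r x (j, u - 1) \<and> edge r j k"
proof -
  obtain i s where x: "x = (i, s)" by fastforce
  have bnd: "i \<le> 2 * r + 1" "k \<le> 2 * r + 1" using assms x by (auto simp: below_def)
  show ?thesis
  proof (cases "u = s + 2 \<and> 1 \<le> i \<and> i \<le> r")
    case True
    then have "k \<le> r \<or> k = 2 * r + 1" using assms x by (auto simp: below_def)
    then show ?thesis
      using True bnd x by (intro exI[of _ "r + i"]) (simp add: below_def edge_def)
  next
    case False
    define j where "j = (if k \<le> r then 0 else k - (r + 1))"
    have j: "j \<le> r" "edge r j k" using bnd by (auto simp: j_def edge_def)
    have "edge r i j" if "u = s + 2"
      using False that bnd j(1) by (auto simp: edge_def)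
    then have "below r x (j, u - 1)"
      using assms(2) j(1) bnd x by (cases "u = s + 2"; cases "u = s + 3") (auto simp: below_def)
    then show ?thesis using j by blast
  qed
qed

lemma below_imp_rtrancl:
  assumes "below r x y"
  shows "(x, y) \<in> (level_covers (matrix_M r))\<^sup>*"
  using assms
proof (induction "nat (snd y - snd x)" arbitrary: y rule: less_induct)
  case less
  obtain k u where y: "y = (k, u)" by fastforce
  show ?case
  proof (cases "u \<ge> snd x + 2")
    case True
    then obtain j where j: "below r x (j, u - 1)" "edge r j k"
      using below_pred less.prems y by blast
    have "(x, (j, u - 1)) \<in> (level_covers (matrix_M r))\<^sup>*"
      using True y by (intro less.hyps j) auto
    moreover have "((j, u - 1), (k, u)) \<in> level_covers (matrix_M r)"
      using j(2) matrix_M_edge[of j r k] by (auto simp: level_covers_def edge_def)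
    ultimately show ?thesis using y by simp
  next
    case False
    then have "edge r (fst x) k" "u = snd x + 1"
      using less.prems y by (auto simp: below_def)
    then have "(x, y) \<in> level_covers (matrix_M r)"
      using matrix_M_edge[of "fst x" r k] y
      by (cases x) (auto simp: level_covers_def edge_def)
    then show ?thesis by simp
  qed
qed

lemma rtrancl_imp_below:
  assumes "(x, y) \<in> (level_covers (matrix_M r))\<^sup>*"
  shows "x = y \<or> below r x y"
  using assms
proof (induction rule: rtrancl_induct)
  case (step y z)
  then obtain j k u where yz: "y = (j, u)" "z = (k, u + 1)"
    and "j < 2 * r + 2" "k < 2 * r + 2" "matrix_M r $$ (j, k) = 1"
    unfolding level_covers_def by (simp del: One_nat_def) blast
  then have "edge r j k" using matrix_M_edge by blast
  moreover from this have "below r (j, u) (k, u + 1)" unfolding below_def by (auto simp: edge_def)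
  ultimately show ?case using step.IH below_step yz by blast
qed simp

lemma level_order_iff:
  "(x, y) \<in> level_order (matrix_M r) \<longleftrightarrow>
     fst x \<le> 2 * r + 1 \<and> fst y \<le> 2 * r + 1 \<and> (x = y \<or> below r x y)"
proof -
  have "x \<in> level_elements (matrix_M r) \<longleftrightarrow> fst x \<le> 2 * r + 1" for x
    by (cases x) (auto simp: level_elements_def)
  then show ?thesis
    unfolding level_order_def using below_imp_rtrancl[of r x y] rtrancl_imp_below[of x y r] by auto
qed

lemma below_less: "below r x y \<Longrightarrow> snd x < snd y"
  by (auto simp: below_def)

lemma below_trans:
  assumes "below r x y" "below r y z"
  shows "below r x z"
proof -
  have "(x, z) \<in> (level_covers (matrix_M r))\<^sup>*"
    using assms[THEN below_imp_rtrancl] by (rule rtrancl_trans)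
  moreover have "x \<noteq> z" using assms[THEN below_less] by auto
  ultimately show ?thesis using rtrancl_imp_below by blast
qed

lemma order_complex_iff:
  assumes "fst x \<le> 2 * r + 1" "fst y \<le> 2 * r + 1"
  shows "C \<in> order_complex (level_order (matrix_M r)) x y \<longleftrightarrow>
     finite C \<and> (\<forall>s\<in>C. \<forall>t\<in>C. s = t \<or> below r s t \<or> below r t s) \<and>
     (\<forall>t\<in>C. below r x t \<and> below r t y)"
proof -
  have above: "aboveS (level_order (matrix_M r)) x = {t. below r x t}"
    using assms by (auto simp: aboveS_def level_order_iff below_def)
  have under: "underS (level_order (matrix_M r)) y = {t. below r t y}"
    using assms by (auto simp: underS_def level_order_iff below_def)
  have fst: "below r x t \<Longrightarrow> fst t \<le> 2 * r + 1" for t by (simp add: below_def)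
  \<comment> \<open>Diagonal pairs lie in \<open>level_order\<close> only for indices in range,
    which being above \<open>x\<close> guarantees.\<close>
  have lo: "(s, t) \<in> level_order (matrix_M r) \<or> (t, s) \<in> level_order (matrix_M r) \<longleftrightarrow>
      s = t \<or> below r s t \<or> below r t s" if "below r x s" "below r x t" for s t
    using that fst by (auto simp: level_order_iff)
  have oc: "order_complex (level_order (matrix_M r)) x y =
      {C. (\<forall>s\<in>C. \<forall>t\<in>C. (s, t) \<in> level_order (matrix_M r) \<or> (t, s) \<in> level_order (matrix_M r)) \<and>
        finite C \<and> (\<forall>t\<in>C. below r x t \<and> below r t y)}"
    by (auto simp: order_complex_def Chains_def above under)
  have eq: "(\<forall>s\<in>C. \<forall>t\<in>C. (s, t) \<in> level_order (matrix_M r) \<or> (t, s) \<in> level_order (matrix_M r)) \<longleftrightarrow>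
      (\<forall>s\<in>C. \<forall>t\<in>C. s = t \<or> below r s t \<or> below r t s)" if "\<forall>t\<in>C. below r x t \<and> below r t y"
    using that by (intro ball_cong refl lo) auto
  show ?thesis
  proof (cases "\<forall>t\<in>C. below r x t \<and> below r t y")
    case True
    show ?thesis unfolding oc mem_Collect_eq eq[OF True] by (rule conj_left_commute)
  next
    case False
    then show ?thesis unfolding oc mem_Collect_eq by (simp only: simp_thms)
  qed
qed

section \<open>Unique representation from a cell decomposition\<close>

text \<open>The set \<open>bd v\<close> collects the vectors carried by chains below
  \<open>v\<close>. The open cell of \<open>t\<close> consists of the positive multiples of
  \<open>p t\<close> plus vectors of \<open>bd t\<close>, that is, of the vectors whose chain has
  largest element \<open>t\<close>. The assumptions make these cells disjoint and free of zero, and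
  let the cells of all \<open>t\<close> below \<open>v\<close> exhaust the nonzero part of
  \<open>bd v\<close>. Peeling off the largest element repeatedly then gives existence and
  uniqueness of chain representations.\<close>

locale cell_decomposition =
  fixes lt :: "'a \<Rightarrow> 'a \<Rightarrow> bool" and V :: "'a set" and p :: "'a \<Rightarrow> 'i \<Rightarrow> real"
    and bd :: "'a \<Rightarrow> ('i \<Rightarrow> real) \<Rightarrow> bool" and lev :: "'a \<Rightarrow> nat"
  assumes lt_trans: "lt s t \<Longrightarrow> lt t v \<Longrightarrow> lt s v"
    and lt_lev: "s \<in> V \<Longrightarrow> t \<in> V \<Longrightarrow> lt s t \<Longrightarrow> lev s < lev t"
    and bd_zero: "v \<in> V \<Longrightarrow> bd v (\<lambda>i. 0)"
    and cell_unique: "\<lbrakk>t \<in> V; t' \<in> V; c > 0; c' > 0;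
        bd t (\<lambda>i. w i - c * p t i); bd t' (\<lambda>i. w i - c' * p t' i)\<rbrakk> \<Longrightarrow> t = t' \<and> c = c'"
    and cell_nonzero: "\<lbrakk>t \<in> V; c > 0; bd t (\<lambda>i. w i - c * p t i)\<rbrakk> \<Longrightarrow> w \<noteq> (\<lambda>i. 0)"
    and cell_bd: "\<lbrakk>t \<in> V; v \<in> V; lt t v; c > 0; bd t (\<lambda>i. w i - c * p t i)\<rbrakk> \<Longrightarrow> bd v w"
    and bd_cell: "\<lbrakk>v \<in> V; bd v w; w \<noteq> (\<lambda>i. 0)\<rbrakk>
        \<Longrightarrow> \<exists>t\<in>V. \<exists>c>0. lt t v \<and> bd t (\<lambda>i. w i - c * p t i)"
begin

definition rep :: "'a \<Rightarrow> ('i \<Rightarrow> real) \<Rightarrow> ('a \<Rightarrow> real) \<Rightarrow> bool" where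
  "rep v w f \<longleftrightarrow> (\<forall>t. 0 \<le> f t) \<and> finite {t. f t \<noteq> 0} \<and>
     (\<forall>s t. f s \<noteq> 0 \<longrightarrow> f t \<noteq> 0 \<longrightarrow> s = t \<or> lt s t \<or> lt t s) \<and>
     (\<forall>t. f t \<noteq> 0 \<longrightarrow> t \<in> V \<and> lt t v) \<and> w = (\<lambda>i. \<Sum>t | f t \<noteq> 0. f t * p t i)"

text \<open>The support is a chain along which \<open>lev\<close> increases, so an element of
  maximal \<open>lev\<close> is its largest; subtracting its share leaves a representation by the
  chain below it.\<close>

lemma rep_top:
  assumes "rep v w f" "f \<noteq> (\<lambda>t. 0)"
  obtains t where "t \<in> V" "lt t v" "f t > 0" "rep t (\<lambda>i. w i - f t * p t i) (f(t := 0))"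
proof -
  let ?S = "{t. f t \<noteq> 0}"
  have S: "finite ?S" "?S \<noteq> {}" using assms by (auto simp: rep_def)
  then have "Max (lev ` ?S) \<in> lev ` ?S" by (intro Max_in) auto
  then obtain t where t: "t \<in> ?S" and "lev t = Max (lev ` ?S)" by auto
  then have max: "lev s \<le> lev t" if "s \<in> ?S" for s using S that by simp
  have lt: "lt s t" if "s \<in> ?S" "s \<noteq> t" for s
  proof -
    have "s \<in> V" "t \<in> V" "lt s t \<or> lt t s" using assms(1) that t unfolding rep_def by auto
    then show ?thesis using lt_lev[of t s] max[OF that(1)] by auto
  qed
  have S': "{s. (f(t := 0)) s \<noteq> 0} = ?S - {t}" by auto
  have "(\<Sum>s\<in>?S - {t}. (f(t := 0)) s * p s i) = (\<Sum>s\<in>?S. f s * p s i) - f t * p t i" for i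
  proof -
    have "(\<Sum>s\<in>?S - {t}. (f(t := 0)) s * p s i) = (\<Sum>s\<in>?S - {t}. f s * p s i)"
      by (intro sum.cong) auto
    then show ?thesis using sum.remove[OF S(1) t, of "\<lambda>s. f s * p s i"] by simp
  qed
  then have "(\<lambda>i. w i - f t * p t i) = (\<lambda>i. \<Sum>s | (f(t := 0)) s \<noteq> 0. (f(t := 0)) s * p s i)"
    using assms(1) unfolding S' by (simp only: rep_def)
  moreover have "\<forall>s. 0 \<le> (f(t := 0)) s" "finite {s. (f(t := 0)) s \<noteq> 0}"
    using assms(1) S unfolding S' by (auto simp: rep_def)
  moreover have "s \<in> V \<and> lt s t" if "s \<in> ?S - {t}" for s
    using assms(1) that lt by (auto simp: rep_def)
  moreover have "s = s' \<or> lt s s' \<or> lt s' s" if "s \<in> ?S - {t}" "s' \<in> ?S - {t}" for s s'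
    using assms(1) that by (auto simp: rep_def)
  ultimately have "rep t (\<lambda>i. w i - f t * p t i) (f(t := 0))"
    unfolding rep_def S'[symmetric] by simp
  then show ?thesis
    using that[of t] assms(1) t by (auto simp: rep_def less_le)
qed

lemma rep_insert:
  assumes "rep t w f" "t \<in> V" "lt t v" "c > 0"
  shows "rep v (\<lambda>i. w i + c * p t i) (f(t := c))"
proof -
  let ?S = "{t. f t \<noteq> 0}"
  have t: "t \<notin> ?S" using assms lt_lev[of t t] by (auto simp: rep_def)
  have S: "{s. (f(t := c)) s \<noteq> 0} = insert t ?S" using assms by auto
  have "(\<Sum>s\<in>insert t ?S. (f(t := c)) s * p s i) = (\<Sum>s\<in>?S. f s * p s i) + c * p t i" for i
  proof -
    have "(\<Sum>s\<in>?S. (f(t := c)) s * p s i) = (\<Sum>s\<in>?S. f s * p s i)"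
      using t by (intro sum.cong) auto
    then show ?thesis using t assms(1) by (simp add: rep_def)
  qed
  then have "(\<lambda>i. w i + c * p t i) =
      (\<lambda>i. \<Sum>s | (f(t := c)) s \<noteq> 0. (f(t := c)) s * p s i)"
    using assms(1) unfolding S by (simp only: rep_def)
  moreover have "\<forall>s. 0 \<le> (f(t := c)) s" "finite {s. (f(t := c)) s \<noteq> 0}"
    using assms unfolding S by (auto simp: rep_def)
  moreover have "s \<in> V \<and> lt s v \<and> (s = t \<or> lt s t)" if "s \<in> insert t ?S" for s
    using assms that lt_trans[of s t v] by (auto simp: rep_def)
  moreover have "s = s' \<or> lt s s' \<or> lt s' s" if "s \<in> insert t ?S" "s' \<in> insert t ?S" for s s'
    using assms(1) that by (auto simp: rep_def)
  ultimately show ?thesis unfolding rep_def S[symmetric] by simp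
qed

lemma rep_imp_bd:
  assumes "rep v w f" "v \<in> V"
  shows "bd v w"
  using assms
proof (induction "lev v" arbitrary: v w f rule: less_induct)
  case less
  show ?case
  proof (cases "f = (\<lambda>t. 0)")
    case True
    then show ?thesis using less.prems bd_zero by (simp add: rep_def)
  next
    case False
    with less.prems(1) obtain t where
      t: "t \<in> V" "lt t v" "f t > 0" "rep t (\<lambda>i. w i - f t * p t i) (f(t := 0))"
      by (rule rep_top)
    then have "bd t (\<lambda>i. w i - f t * p t i)"
      using less.hyps lt_lev less.prems(2) by blast
    then show ?thesis using cell_bd t less.prems(2) by blast
  qed
qed

lemma rep_exists:
  assumes "bd v w" "v \<in> V"
  shows "\<exists>f. rep v w f"
  using assms
proof (induction "lev v" arbitrary: v w rule: less_induct)
  case less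
  show ?case
  proof (cases "w = (\<lambda>i. 0)")
    case True
    then show ?thesis by (intro exI[of _ "\<lambda>t. 0"]) (simp add: rep_def)
  next
    case False
    then obtain t c where t: "t \<in> V" "c > 0" "lt t v" "bd t (\<lambda>i. w i - c * p t i)"
      using bd_cell less.prems by blast
    then obtain f where "rep t (\<lambda>i. w i - c * p t i) f"
      using less.hyps lt_lev less.prems(2) by blast
    from rep_insert[OF this t(1,3,2)] show ?thesis by auto
  qed
qed

lemma rep_nonzero:
  assumes "rep v w f" "f \<noteq> (\<lambda>t. 0)"
  shows "w \<noteq> (\<lambda>i. 0)"
proof -
  obtain t where "t \<in> V" "f t > 0" "rep t (\<lambda>i. w i - f t * p t i) (f(t := 0))"
    using assms by (rule rep_top)
  then show ?thesis by (intro cell_nonzero[OF _ _ rep_imp_bd])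
qed

text \<open>By \<open>cell_unique\<close> the vector determines the largest vertex and its
  coefficient; the remainders agree by induction on \<open>lev\<close>. \<open>rep_nonzero\<close>
  excludes that only one of the representations is trivial.\<close>

lemma rep_unique:
  assumes "rep v w f" "rep v w f'" "v \<in> V"
  shows "f = f'"
  using assms
proof (induction "lev v" arbitrary: v w f f' rule: less_induct)
  case less
  have zero: "w = (\<lambda>i. 0)" if "rep v w (\<lambda>t. 0)" for w using that by (simp add: rep_def)
  show ?case
  proof (cases "f = (\<lambda>t. 0) \<or> f' = (\<lambda>t. 0)")
    case True
    then show ?thesis using less.prems rep_nonzero zero by blast
  next
    case False
    obtain t where
      t: "t \<in> V" "lt t v" "f t > 0" "rep t (\<lambda>i. w i - f t * p t i) (f(t := 0))"
      using less.prems(1) False rep_top[of v w f] by blast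
    obtain t' where
      t': "t' \<in> V" "lt t' v" "f' t' > 0" "rep t' (\<lambda>i. w i - f' t' * p t' i) (f'(t' := 0))"
      using less.prems(2) False rep_top[of v w f'] by blast
    have eq: "t = t'" "f t = f' t'"
      using cell_unique[OF t(1) t'(1) t(3) t'(3) rep_imp_bd[OF t(4,1)] rep_imp_bd[OF t'(4,1)]] by auto
    then have "f(t := 0) = f'(t := 0)"
      using less.hyps[of t] t t' lt_lev less.prems(3) by auto
    then show ?thesis using eq by (metis fun_upd_triv fun_upd_upd)
  qed
qed

end

section \<open>The cells of the fan\<close>

definition ray_x :: "nat \<Rightarrow> nat \<Rightarrow> real" where
  "ray_x r j = (if j = 0 then -1 else if j = Suc r then 1 else 2 * real j)"

definition ray_y :: "nat \<Rightarrow> nat \<Rightarrow> real" where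
  "ray_y r j = (if j = 0 \<or> j = Suc r then 0 else 1)"

text \<open>For \<open>c > 0\<close> and \<open>j \<le> r\<close> the point lies in the open sector
  between rays \<open>j\<close> and \<open>j + 1\<close>, which the direction
  \<open>(2 * j + 1, 1)\<close> cuts in two; \<open>c\<close> is the coefficient of that direction
  and \<open>i\<close> names the half.\<close>

definition wedge :: "nat \<Rightarrow> nat \<Rightarrow> real \<Rightarrow> real \<Rightarrow> real \<Rightarrow> bool" where
  "wedge r j c x y \<longleftrightarrow> (\<exists>i\<in>{j, Suc j}. \<exists>m\<ge>0.
     x - c * (2 * real j + 1) = m * ray_x r i \<and> y - c = m * ray_y r i)"

text \<open>To read off \<open>c\<close> without knowing the half, take for each bounding ray the
  linear function vanishing on it with value 1 at the middle direction. On the half next to a ray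
  its function equals \<open>c\<close>, and the other one is no smaller.\<close>

lemma wedgeD:
  assumes "wedge r j c x y" "c > 0" "j \<le> r"
  shows "y > 0" "j \<noteq> 0 \<Longrightarrow> x > 2 * real j * y" "j \<noteq> r \<Longrightarrow> x < (2 * real j + 2) * y"
    "c = min (if j = 0 then y else x - 2 * real j * y)
             (if j = r then y else (2 * real j + 2) * y - x)"
proof -
  obtain i m where i: "i = j \<or> i = Suc j" "m \<ge> 0"
    and eq: "x = c * (2 * real j + 1) + m * ray_x r i" "y = c + m * ray_y r i"
    using assms(1) by (auto simp: wedge_def algebra_simps)
  show "y > 0" "j \<noteq> 0 \<Longrightarrow> x > 2 * real j * y" "j \<noteq> r \<Longrightarrow> x < (2 * real j + 2) * y"
    "c = min (if j = 0 then y else x - 2 * real j * y)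
             (if j = r then y else (2 * real j + 2) * y - x)"
    using i assms(2,3) unfolding eq
    by (auto simp: ray_x_def ray_y_def algebra_simps min_def)
qed

lemma wedge_exists:
  assumes "y > 0" "j \<le> r" "j \<noteq> 0 \<Longrightarrow> x > 2 * real j * y" "j \<noteq> r \<Longrightarrow> x < (2 * real j + 2) * y"
  shows "\<exists>c>0. wedge r j c x y"
proof (cases "x \<le> (2 * real j + 1) * y")
  case True
  then show ?thesis using assms
    by (intro exI[of _ "if j = 0 then y else x - 2 * real j * y"])
       (auto simp: wedge_def ray_x_def ray_y_def algebra_simps
             intro!: exI[of _ "(2 * real j + 1) * y - x"])
next
  case False
  then show ?thesis using assms
    by (intro exI[of _ "if j = r then y else (2 * real j + 2) * y - x"])
       (auto simp: wedge_def ray_x_def ray_y_def algebra_simps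
             intro!: exI[of _ "x - (2 * real j + 1) * y"])
qed

lemma ray_or_wedge:
  assumes "y > 0"
  shows "(\<exists>j. 1 \<le> j \<and> j \<le> r \<and> x = 2 * real j * y) \<or> (\<exists>j\<le>r. \<exists>c>0. wedge r j c x y)"
proof -
  define M where "M = {j. j \<le> r \<and> (j = 0 \<or> x \<ge> 2 * real j * y)}"
  define j where "j = Max M"
  have fin: "finite M" by (simp add: M_def)
  have "j \<in> M" unfolding j_def using fin by (intro Max_in) (auto simp: M_def)
  then have j: "j \<le> r" "j \<noteq> 0 \<Longrightarrow> x \<ge> 2 * real j * y" by (auto simp: M_def)
  have "x < (2 * real j + 2) * y" if "j \<noteq> r"
  proof (rule ccontr)
    assume "\<not> ?thesis"
    then have "Suc j \<in> M" using that j(1) by (simp add: M_def algebra_simps)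
    then have "Suc j \<le> j" using fin unfolding j_def by simp
    then show False by simp
  qed
  moreover have "j \<noteq> 0 \<Longrightarrow> x > 2 * real j * y" if "\<not> (j \<noteq> 0 \<and> x = 2 * real j * y)"
    using j(2) that by linarith
  ultimately have "\<exists>c>0. wedge r j c x y" if "\<not> (j \<noteq> 0 \<and> x = 2 * real j * y)"
    using wedge_exists[OF assms j(1), of x] that by blast
  moreover have "1 \<le> j" if "j \<noteq> 0" using that by simp
  ultimately show ?thesis using j(1) by blast
qed

text \<open>The bottom level \<open>b\<close> of the interval consists of the vertices \<open>i \<le> r\<close> and the single vertex
  \<open>d\<close>; the latter is \<open>r + 1\<close> or \<open>2 * r + 1\<close> depending on the element below the interval.\<close>

locale level_fan =
  fixes r d :: nat and b :: int
  assumes d: "d = r + 1 \<or> d = 2 * r + 1"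
begin

definition V :: "(nat \<times> int) set" where
  "V = {(i, s). i \<le> 2 * r + 1 \<and> b \<le> s \<and> (s = b \<longrightarrow> i \<le> r \<or> i = d)}"

text \<open>The test \<open>s \<noteq> b\<close> drops the coordinate below the bottom level, so
  \<open>(d, b)\<close> gets the plain unit vector.\<close>

definition vec :: "nat \<times> int \<Rightarrow> int \<Rightarrow> real" where
  "vec = (\<lambda>(i, s) k.
     if i \<le> r then if k = s then ray_x r i else if k = s + 1 then ray_y r i else 0
     else if k = s then 1
     else if k = s - 1 \<and> s \<noteq> b then 2 * real (i - Suc r) + 1 else 0)"

definition supp :: "int \<Rightarrow> (int \<Rightarrow> real) \<Rightarrow> bool" where
  "supp m w \<longleftrightarrow> (\<forall>k. k < b \<or> m < k \<longrightarrow> w k = 0)"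

text \<open>\<open>bd v\<close> is the union of the cones over the chains below \<open>v\<close>.\<close>

definition bd :: "nat \<times> int \<Rightarrow> (int \<Rightarrow> real) \<Rightarrow> bool" where
  "bd = (\<lambda>(i, s) w.
     if i \<le> r then supp (s - 1) w
     else if s = b then supp (b - 1) w
     else supp s w \<and> (\<exists>j\<in>{i - Suc r, Suc (i - Suc r)}. \<exists>m\<ge>0.
            w (s - 1) = m * ray_x r j \<and> w s = m * ray_y r j))"

definition cell :: "nat \<times> int \<Rightarrow> real \<Rightarrow> (int \<Rightarrow> real) \<Rightarrow> bool" where
  "cell t c w \<longleftrightarrow> c > 0 \<and> bd t (\<lambda>k. w k - c * vec t k)"

lemma d_greater: "r < d" using d by auto

lemma supp_mono: "supp m w \<Longrightarrow> m \<le> n \<Longrightarrow> supp n w"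
  by (auto simp: supp_def)

lemma supp_zero: "supp m (\<lambda>k. 0)"
  by (simp add: supp_def)

lemma supp_pred:
  assumes "b \<le> s"
  shows "supp (s - 1) w \<longleftrightarrow> supp s w \<and> w s = 0"
proof -
  have "k < b \<or> s - 1 < k \<longleftrightarrow> (k < b \<or> s < k) \<or> k = s" for k using assms by auto
  then show ?thesis by (auto simp: supp_def)
qed

text \<open>Subtracting \<open>c * vec (i, s)\<close> must clear coordinates \<open>s\<close> and
  \<open>s + 1\<close>; the lower ones are free because \<open>bd (i, s)\<close> is a full
  coordinate subspace.\<close>

lemma cell_ray:
  assumes "i \<le> r" "b \<le> s"
  shows "cell (i, s) c w \<longleftrightarrow>
    c > 0 \<and> supp (s + 1) w \<and> w s = c * ray_x r i \<and> w (s + 1) = c * ray_y r i"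
proof -
  let ?u = "\<lambda>k. w k - c * vec (i, s) k"
  have "supp (s - 1) ?u \<longleftrightarrow> (supp (s + 1) ?u \<and> ?u (s + 1) = 0) \<and> ?u s = 0"
    using supp_pred[of s ?u] supp_pred[of "s + 1" ?u] assms(2) by simp
  moreover have "supp (s + 1) ?u \<longleftrightarrow> supp (s + 1) w"
    using assms by (simp add: supp_def vec_def)
  moreover have "cell (i, s) c w \<longleftrightarrow> c > 0 \<and> supp (s - 1) ?u"
    using assms(1) by (simp add: cell_def bd_def)
  moreover have "?u s = w s - c * ray_x r i" "?u (s + 1) = w (s + 1) - c * ray_y r i"
    using assms(1) by (simp_all add: vec_def)
  ultimately show ?thesis by auto
qed

lemma cell_base: "cell (d, b) c w \<longleftrightarrow> c > 0 \<and> supp b w \<and> w b = c"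
proof -
  let ?u = "\<lambda>k. w k - c * vec (d, b) k"
  have vec: "vec (d, b) k = (if k = b then 1 else 0)" for k
    using d_greater by (simp add: vec_def)
  have "supp (b - 1) ?u \<longleftrightarrow> supp b ?u \<and> ?u b = 0"
    by (rule supp_pred) simp
  moreover have "supp b ?u \<longleftrightarrow> supp b w"
    by (simp add: supp_def vec)
  moreover have "cell (d, b) c w \<longleftrightarrow> c > 0 \<and> supp (b - 1) ?u"
    using d_greater by (simp add: cell_def bd_def)
  ultimately show ?thesis by (auto simp: vec)
qed

lemma cell_lens:
  assumes "r < i" "b < s"
  shows "cell (i, s) c w \<longleftrightarrow> c > 0 \<and> supp s w \<and> wedge r (i - Suc r) c (w (s - 1)) (w s)"
proof -
  have "supp s (\<lambda>k. w k - c * vec (i, s) k) = supp s w"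
    using assms by (simp add: supp_def vec_def)
  then show ?thesis
    using assms by (simp add: cell_def bd_def wedge_def vec_def)
qed

text \<open>The cells are sorted by the last nonzero coordinate \<open>k\<close>. Among the indices
  up to \<open>r\<close>, \<open>ray_y\<close> vanishes only at 0, so \<open>(i, s)\<close> has
  \<open>k = s\<close> for \<open>i = 0\<close> but \<open>k = s + 1\<close> for
  \<open>1 \<le> i \<le> r\<close>.\<close>

lemma cell_cases:
  assumes "t \<in> V" "cell t c w"
  obtains (bottom) k where "b \<le> k" "supp k w" "t = (0, k)" "w k = -c" "c > 0"
  | (base) "supp b w" "t = (d, b)" "w b = c" "c > 0"
  | (ray) k i where "b < k" "supp k w" "1 \<le> i" "i \<le> r" "t = (i, k - 1)" "w k = c" "c > 0"
      "w (k - 1) = 2 * real i * w k"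
  | (lens) k j where "b < k" "supp k w" "j \<le> r" "t = (Suc r + j, k)" "c > 0" "w k > 0"
      "wedge r j c (w (k - 1)) (w k)"
proof -
  obtain i s where t: "t = (i, s)" by fastforce
  have V: "i \<le> 2 * r + 1" "b \<le> s" "s = b \<Longrightarrow> i \<le> r \<or> i = d" using assms t by (auto simp: V_def)
  consider "i = 0" | "1 \<le> i" "i \<le> r" | "r < i" "s = b" | "r < i" "b < s" using V by linarith
  then show ?thesis
  proof cases
    case 1
    then have "c > 0" "w s = -c" "w (s + 1) = 0" "supp (s + 1) w"
      using assms V t cell_ray[of i s c w] by (auto simp: ray_x_def ray_y_def)
    moreover from this have "supp s w"
      unfolding supp_def by (metis zless_imp_add1_zle order_le_less)
    ultimately show ?thesis using V t 1 bottom by blast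
  next
    case 2
    then show ?thesis
      using assms V t cell_ray[of i s c w] ray[of "s + 1" i] by (auto simp: ray_x_def ray_y_def)
  next
    case 3
    then show ?thesis using assms V t cell_base base by auto
  next
    case 4
    then show ?thesis
      using assms V t cell_lens[of i s c w] lens[of s "i - Suc r"] wedgeD(1)[of r "i - Suc r" c] by auto
  qed
qed

lemma cell_top:
  assumes "t \<in> V" "cell t c w"
  shows "\<exists>k\<ge>b. supp k w \<and> w k \<noteq> 0"
  using assms
proof (cases rule: cell_cases)
  case (ray k i)
  then show ?thesis by (intro exI[of _ k]) auto
next
  case (lens k j)
  then show ?thesis by (intro exI[of _ k]) auto
qed auto

lemma supp_unique: "b \<le> k \<Longrightarrow> b \<le> k' \<Longrightarrow> supp k w \<Longrightarrow> supp k' w \<Longrightarrow> w k \<noteq> 0 \<Longrightarrow> w k' \<noteq> 0 \<Longrightarrow> k = k'"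
  by (meson linorder_neqE supp_def)

end

lemma ray_not_wedge:
  assumes "y > 0" "1 \<le> i" "i \<le> r" "j \<le> r" "c > 0"
  shows "\<not> wedge r j c (2 * real i * y) y"
proof
  assume w: "wedge r j c (2 * real i * y) y"
  show False
  proof (cases "i \<le> j")
    case True
    then have "2 * real i * y \<le> 2 * real j * y" using assms(1) by simp
    then show False using wedgeD(2)[OF w] assms True by simp
  next
    case False
    then have "(2 * real j + 2) * y \<le> 2 * real i * y" using assms(1) by simp
    then show False using wedgeD(3)[OF w] assms False by simp
  qed
qed

lemma wedge_unique:
  assumes "wedge r j c x y" "wedge r j' c' x y" "j \<le> r" "j' \<le> r" "c > 0" "c' > 0"
  shows "j = j' \<and> c = c'"
proof -
  have y: "y > 0" using wedgeD(1) assms by blast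
  have False if "wedge r k a x y" "wedge r l e x y" "k \<le> r" "l \<le> r" "a > 0" "e > 0" "k < l" for k l a e
  proof -
    have "x < (2 * real k + 2) * y" using wedgeD(3)[of r k a x y] that by auto
    also have "\<dots> \<le> 2 * real l * y" using y that by (intro mult_right_mono) auto
    also have "\<dots> < x" using wedgeD(2)[of r l e x y] that by auto
    finally show False .
  qed
  then have "j = j'" using assms by (metis linorder_neqE_nat)
  then show ?thesis using wedgeD(4)[of r j c x y] wedgeD(4)[of r j c' x y] assms by metis
qed

text \<open>The functional \<open>x - (2 * j + 1) * y\<close> vanishes on the middle direction of
  sector \<open>j\<close> and lays its two rays out on the two sides of one line; this is how
  \<open>proj\<close> flattens \<open>bd\<close>.\<close>

lemma ray_diff:
  assumes "j \<le> r"
  shows "ray_x r j - (2 * real j + 1) * ray_y r j = -1"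
    "ray_x r (Suc j) - (2 * real j + 1) * ray_y r (Suc j) = 1"
  using assms by (auto simp: ray_x_def ray_y_def)

section \<open>The cell of a vector and its position in the order\<close>

context level_fan
begin

text \<open>\<open>k\<close> is the last nonzero coordinate of all vectors in the open cell of \<open>t\<close>.\<close>

definition leading :: "nat \<times> int \<Rightarrow> int \<Rightarrow> bool" where
  "leading t k \<longleftrightarrow> fst t \<le> 2 * r + 1 \<and> snd t = (if 1 \<le> fst t \<and> fst t \<le> r then k - 1 else k)"

lemma cell_at:
  assumes "t \<in> V" "cell t c w" "supp k w" "w k \<noteq> 0" "b \<le> k"
  shows "w k < 0 \<and> t = (0, k) \<and> c = - w k \<or>
    k = b \<and> w k > 0 \<and> t = (d, b) \<and> c = w k \<or>
    b < k \<and> w k > 0 \<and> (\<exists>i. 1 \<le> i \<and> i \<le> r \<and> t = (i, k - 1) \<and> w (k - 1) = 2 * real i * w k \<and> c = w k) \<or>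
    b < k \<and> w k > 0 \<and> (\<exists>j\<le>r. t = (Suc r + j, k) \<and> c > 0 \<and> wedge r j c (w (k - 1)) (w k))"
  using assms(1,2)
proof (cases rule: cell_cases)
  case (bottom k')
  then have "k' = k" using supp_unique[of k' k w] assms by auto
  with bottom show ?thesis by auto
next
  case base
  then have "b = k" using supp_unique[of b k w] assms by auto
  with base show ?thesis by auto
next
  case (ray k' i)
  then have "k' = k" using supp_unique[of k' k w] assms by auto
  with ray show ?thesis by blast
next
  case (lens k' j)
  then have "k' = k" using supp_unique[of k' k w] assms by auto
  with lens show ?thesis by blast
qed

lemma cell_at_leading:
  assumes "t \<in> V" "cell t c w" "supp k w" "w k \<noteq> 0" "b \<le> k"
  shows "leading t k" "fst t \<noteq> 0 \<Longrightarrow> w k > 0"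
  using cell_at[OF assms] d by (auto simp: leading_def)

text \<open>Both cells share the last nonzero coordinate \<open>k\<close>, and a negative value
  there singles out \<open>(0, k)\<close>. Above the bottom level a positive value leaves rays and
  sectors, which are disjoint in the plane of coordinates \<open>k - 1\<close> and
  \<open>k\<close>.\<close>

lemma cell_unique:
  assumes "t \<in> V" "t' \<in> V" "cell t c w" "cell t' c' w"
  shows "t = t' \<and> c = c'"
proof -
  obtain k where k: "supp k w" "w k \<noteq> 0" "b \<le> k" using cell_top assms by blast
  note at = cell_at[OF assms(1,3) k] cell_at[OF assms(2,4) k]
  consider "w k < 0" | "k = b" "w k > 0" | "b < k" "w k > 0" using k by linarith
  then show ?thesis
  proof cases
    case 1
    then show ?thesis using at by auto
  next
    case 2
    then show ?thesis using at by auto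
  next
    case 3
    have ex: "(\<exists>i. 1 \<le> i \<and> i \<le> r \<and> s = (i, k - 1) \<and> w (k - 1) = 2 * real i * w k \<and> a = w k) \<or>
        (\<exists>j\<le>r. s = (Suc r + j, k) \<and> a > 0 \<and> wedge r j a (w (k - 1)) (w k))"
      if "s \<in> V" "cell s a w" for s a
    proof -
      have "\<not> w k < 0" "k \<noteq> b" using 3 by auto
      then show ?thesis using cell_at[OF that k] by blast
    qed
    show ?thesis
      using ex[OF assms(1,3)] ex[OF assms(2,4)]
    proof (elim disjE exE conjE)
      fix i i'
      assume "t = (i, k - 1)" "t' = (i', k - 1)" "c = w k" "c' = w k"
        "w (k - 1) = 2 * real i * w k" "w (k - 1) = 2 * real i' * w k"
      then show ?thesis using 3 by simp
    next
      fix j j'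
      assume "t = (Suc r + j, k)" "t' = (Suc r + j', k)" "j \<le> r" "j' \<le> r" "c > 0" "c' > 0"
        "wedge r j c (w (k - 1)) (w k)" "wedge r j' c' (w (k - 1)) (w k)"
      then show ?thesis using wedge_unique by blast
    next
      fix i j
      assume "1 \<le> i" "i \<le> r" "j \<le> r" "c' > 0" "w (k - 1) = 2 * real i * w k"
        "wedge r j c' (w (k - 1)) (w k)"
      then show ?thesis using ray_not_wedge[of "w k" i r j c'] 3 by simp
    next
      fix i j
      assume "1 \<le> i" "i \<le> r" "j \<le> r" "c > 0" "w (k - 1) = 2 * real i * w k"
        "wedge r j c (w (k - 1)) (w k)"
      then show ?thesis using ray_not_wedge[of "w k" i r j c] 3 by simp
    qed
  qed
qed

lemma top_coordinate:
  assumes "supp m w" "w \<noteq> (\<lambda>k. 0)"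
  obtains k where "b \<le> k" "k \<le> m" "supp k w" "w k \<noteq> 0"
proof -
  define M where "M = {k \<in> {b..m}. w k \<noteq> 0}"
  obtain k where "w k \<noteq> 0" using assms(2) by auto
  then have "k \<in> M" using assms(1) unfolding M_def supp_def by force
  moreover have fin: "finite M" by (rule finite_subset[of _ "{b..m}"]) (auto simp: M_def)
  ultimately have Max: "Max M \<in> M" by (intro Max_in) auto
  have "supp (Max M) w"
    unfolding supp_def
  proof (intro allI impI)
    fix k assume k: "k < b \<or> Max M < k"
    have "k \<notin> M"
    proof
      assume "k \<in> M"
      moreover from this have "b \<le> k" by (simp add: M_def)
      ultimately show False using Max_ge[OF fin, of k] k by simp
    qed
    then have "w k = 0 \<or> k < b \<or> m < k" unfolding M_def by auto
    then show "w k = 0" using assms(1) by (auto simp: supp_def)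
  qed
  with Max show ?thesis by (intro that[of "Max M"]) (auto simp: M_def)
qed

lemma cell_exists:
  assumes "supp k w" "w k \<noteq> 0" "b \<le> k"
  obtains t c where "t \<in> V" "cell t c w" "leading t k" "w k > 0 \<Longrightarrow> fst t \<noteq> 0"
proof -
  consider "w k < 0" | "k = b" "w k > 0" | "b < k" "w k > 0" using assms by linarith
  then show ?thesis
  proof cases
    case 1
    have "supp (k + 1) w" "w (k + 1) = 0" using assms(1) by (auto simp: supp_def)
    then have "cell (0, k) (- w k) w"
      using 1 assms by (simp add: cell_ray ray_x_def ray_y_def)
    moreover have "(0, k) \<in> V" using assms by (simp add: V_def)
    ultimately show ?thesis using that 1 by (force simp: leading_def)
  next
    case 2
    then have "cell (d, b) (w b) w" using assms by (simp add: cell_base)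
    moreover have "(d, b) \<in> V" using d by (auto simp: V_def)
    ultimately show ?thesis using that 2 d by (force simp: leading_def)
  next
    case 3
    consider i where "1 \<le> i" "i \<le> r" "w (k - 1) = 2 * real i * w k"
      | j c where "j \<le> r" "c > 0" "wedge r j c (w (k - 1)) (w k)"
      using ray_or_wedge[of "w k" r "w (k - 1)"] 3 by blast
    then show ?thesis
    proof cases
      case (1 i)
      then have "cell (i, k - 1) (w k) w"
        using 3 assms by (subst cell_ray) (auto simp: ray_x_def ray_y_def)
      moreover have "(i, k - 1) \<in> V" using 1 3 by (simp add: V_def)
      ultimately show ?thesis using that[of "(i, k - 1)"] 1 by (simp add: leading_def)
    next
      case (2 j c)
      then have "cell (Suc r + j, k) c w"
        using 3 assms by (subst cell_lens) auto
      moreover have "(Suc r + j, k) \<in> V" using 2 3 by (simp add: V_def)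
      ultimately show ?thesis using that[of "(Suc r + j, k)"] 2 by (simp add: leading_def)
    qed
  qed
qed

text \<open>A vertex with index from 1 to \<open>r\<close> reaches fewer elements, but it sits one
  level under its leading coordinate, which compensates. Hence a bound on \<open>k\<close> decides
  the relation, with a condition on the sign when \<open>i = 2 * r + 1\<close>.\<close>

lemma leading_below:
  assumes "leading t k" "i \<le> 2 * r + 1"
    "k \<le> m - 2 \<or> k = m - 1 \<and> i \<le> r \<or> k = m - 1 \<and> i = 2 * r + 1 \<and> fst t \<noteq> 0"
  shows "below r t (i, m)"
proof -
  obtain a s where t: "t = (a, s)" by fastforce
  show ?thesis
  proof (cases "1 \<le> a \<and> a \<le> r")
    case True
    then show ?thesis using assms t by (auto simp: leading_def below_def)
  next
    case False
    then have "s = k" "a \<le> 2 * r + 1" using assms t by (auto simp: leading_def split: if_splits)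
    moreover have "edge r a i" if "k = m - 1"
      using that assms(2,3) False \<open>a \<le> 2 * r + 1\<close> t by (auto simp: edge_def)
    moreover have "a = 0 \<or> a > r" using False by auto
    ultimately show ?thesis using assms(2,3) t by (auto simp: below_def)
  qed
qed

lemma below_leading:
  assumes "below r t (i, m)" "leading t k"
  shows "i \<le> r \<Longrightarrow> k \<le> m - 1"
    and "r < i \<Longrightarrow> k \<le> m - 2 \<or>
      snd t = m - 1 \<and> fst t \<le> r \<and> (fst t = i - Suc r \<or> fst t = Suc (i - Suc r)) \<or>
      i = 2 * r + 1 \<and> k = m - 1 \<and> fst t \<noteq> 0"
proof -
  obtain a s where t: "t = (a, s)" by fastforce
  show "k \<le> m - 1" if "i \<le> r"
    using assms that t by (auto simp: below_def leading_def edge_def split: if_splits)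
  show "k \<le> m - 2 \<or>
      snd t = m - 1 \<and> fst t \<le> r \<and> (fst t = i - Suc r \<or> fst t = Suc (i - Suc r)) \<or>
      i = 2 * r + 1 \<and> k = m - 1 \<and> fst t \<noteq> 0" if "r < i"
    using assms that t by (auto simp: below_def leading_def edge_def split: if_splits)
qed

text \<open>For \<open>r < i\<close> the alternatives of \<open>below_leading\<close> are the pieces
  of \<open>bd (i, m)\<close>: the common boundary where both top coordinates vanish, the rays of
  adjacent vertices at level \<open>m - 1\<close>, and, for \<open>i = 2 * r + 1\<close>, the
  positive direction of coordinate \<open>m - 1\<close>, which is ray \<open>r + 1\<close>.\<close>

lemma bd_mono:
  assumes "t \<in> V" "v \<in> V" "below r t v" "cell t c w"
  shows "bd v w"
proof -
  obtain i m where v: "v = (i, m)" by fastforce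
  obtain k where k: "supp k w" "w k \<noteq> 0" "b \<le> k" using cell_top assms by blast
  note top = cell_at_leading[OF assms(1,4) k]
  have vV: "i \<le> 2 * r + 1" "b \<le> m" using assms(2) v by (auto simp: V_def)
  have lt: "snd t < m" "b \<le> snd t" using below_less[OF assms(3)] v assms(1) by (auto simp: V_def)
  show ?thesis
  proof (cases "i \<le> r")
    case True
    then have "k \<le> m - 1" using below_leading(1) assms(3) top(1) v by blast
    then show ?thesis using supp_mono[OF k(1)] True v by (simp add: bd_def)
  next
    case False
    define j where "j = i - Suc r"
    have bdI: "bd v w" if "supp m w" "p = j \<or> p = Suc j" "a \<ge> 0" "w (m - 1) = a * ray_x r p" "w m = a * ray_y r p" for p a
      using that False lt v unfolding bd_def j_def by auto
    consider "k \<le> m - 2" | "snd t = m - 1" "fst t \<le> r" "fst t = j \<or> fst t = Suc j"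
      | "i = 2 * r + 1" "k = m - 1" "fst t \<noteq> 0"
      using below_leading(2)[of t i m k] assms(3) top(1) v False unfolding j_def by auto
    then show ?thesis
    proof cases
      case 1
      then have "supp m w" "w (m - 1) = 0" "w m = 0" using k(1) by (auto simp: supp_def)
      then show ?thesis by (intro bdI[of j 0]) auto
    next
      case 2
      then show ?thesis
        using assms(4) cell_ray[of "fst t" "m - 1" c w] lt by (intro bdI[of "fst t" c]) (cases t; auto)+
    next
      case 3
      then have "supp m w" "w m = 0" using k(1) by (auto simp: supp_def)
      then show ?thesis
        using top(2) 3 by (intro bdI[of "Suc j" "w (m - 1)"]) (auto simp: j_def ray_x_def ray_y_def)
    qed
  qed
qed

lemma bd_cell:
  assumes "v \<in> V" "bd v w" "w \<noteq> (\<lambda>k. 0)"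
  shows "\<exists>t\<in>V. \<exists>c. below r t v \<and> cell t c w"
proof -
  obtain i m where v: "v = (i, m)" by fastforce
  have vV: "i \<le> 2 * r + 1" "b \<le> m" using assms(1) v by (auto simp: V_def)
  have low: ?thesis if w: "supp l w" "l \<le> m - 2 \<or> l = m - 1 \<and> i \<le> r" for l
  proof -
    obtain k where k: "b \<le> k" "k \<le> l" "supp k w" "w k \<noteq> 0"
      using top_coordinate[OF w(1) assms(3)] by blast
    obtain t c where t: "t \<in> V" "cell t c w" "leading t k"
      by (rule cell_exists[OF k(3,4,1)])
    then have "below r t v"
      unfolding v using vV w(2) k(2) by (intro leading_below[of t k]) auto
    with t show ?thesis by blast
  qed
  show ?thesis
  proof (cases "i \<le> r \<or> m = b")
    case True
    show ?thesis
    proof (cases "i \<le> r")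
      case True
      then show ?thesis using assms(2) v by (intro low[of "m - 1"]) (auto simp: bd_def)
    next
      case False
      \<comment> \<open>Nothing lies below \<open>(d, b)\<close>: its \<open>bd\<close> is zero
        alone, which contradicts \<open>w\<close> being nonzero.\<close>
      then have "supp (b - 1) w" using True assms(2) v by (simp add: bd_def)
      then show ?thesis using top_coordinate[of "b - 1" w] assms(3) by (metis diff_add_cancel zle_diff1_eq not_less)
    qed
  next
    case False
    define j where "j = i - Suc r"
    have ij: "i = Suc r + j" "j \<le> r" using False vV by (auto simp: j_def)
    have mb: "b \<le> m - 1" using False vV by auto
    obtain p a where p: "p = j \<or> p = Suc j" "a \<ge> 0" "w (m - 1) = a * ray_x r p" "w m = a * ray_y r p"
      and w: "supp m w"
      using assms(2) False v unfolding bd_def j_def by auto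
    \<comment> \<open>Rays up to \<open>r\<close> come from the vertices \<open>(p, m - 1)\<close>.
      Over ray \<open>r + 1\<close> the last nonzero coordinate is \<open>m - 1\<close> and
      positive, so \<open>cell_exists\<close> applies there and yields a vertex of nonzero
      index.\<close>
    consider "a = 0" | "a > 0" "p \<le> r" | "a > 0" "p = Suc r" "j = r" using p ij by linarith
    then show ?thesis
    proof cases
      case 1
      then have "supp (m - 1 - 1) w" using supp_pred[of m w] supp_pred[of "m - 1" w] w p mb vV by simp
      then show ?thesis by (intro low) auto
    next
      case 2
      then have "cell (p, m - 1) a w" using p w mb by (simp add: cell_ray)
      moreover have "(p, m - 1) \<in> V" using 2 mb by (simp add: V_def)
      moreover have "edge r p i" using p(1) 2 ij by (auto simp: edge_def)
      then have "below r (p, m - 1) v" using 2 v vV by (simp add: below_def)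
      ultimately show ?thesis by blast
    next
      case 3
      then have "w m = 0" "w (m - 1) > 0" using p by (auto simp: ray_x_def ray_y_def)
      moreover from this have "supp (m - 1) w" using supp_pred[of m w] w vV by simp
      ultimately obtain t c where t: "t \<in> V" "cell t c w" "leading t (m - 1)" "fst t \<noteq> 0"
        using cell_exists[of "m - 1" w] mb by (metis less_irrefl)
      moreover have "below r t v"
        unfolding v using t vV 3 ij by (intro leading_below[of t "m - 1"]) auto
      ultimately show ?thesis by blast
    qed
  qed
qed

lemma bd_zero: "bd v (\<lambda>k. 0)"
  by (cases v) (auto simp: bd_def supp_zero)

sublocale cell_decomposition "below r" V vec bd "\<lambda>v. nat (snd v - b)"
proof
  fix s t v :: "nat \<times> int" and w c
  show "below r s t \<Longrightarrow> below r t v \<Longrightarrow> below r s v" by (rule below_trans)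
  show "s \<in> V \<Longrightarrow> t \<in> V \<Longrightarrow> below r s t \<Longrightarrow> nat (snd s - b) < nat (snd t - b)"
    using below_less[of r s t] by (auto simp: V_def)
  show "bd v (\<lambda>k. 0)" by (rule bd_zero)
  show "w \<noteq> (\<lambda>k. 0)" if "t \<in> V" "c > 0" "bd t (\<lambda>k. w k - c * vec t k)"
    using cell_top[of t c w] that by (auto simp: cell_def)
  show "bd v w" if "t \<in> V" "v \<in> V" "below r t v" "c > 0" "bd t (\<lambda>k. w k - c * vec t k)"
    using bd_mono[of t v c w] that by (simp add: cell_def)
  show "\<exists>t\<in>V. \<exists>c>0. below r t v \<and> bd t (\<lambda>k. w k - c * vec t k)"
    if "v \<in> V" "bd v w" "w \<noteq> (\<lambda>k. 0)"
    using bd_cell[OF that] unfolding cell_def by blast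
next
  fix t t' c c' w
  show "t = t' \<and> c = c'" if "t \<in> V" "t' \<in> V" "c > 0" "c' > 0"
    "bd t (\<lambda>k. w k - c * vec t k)" "bd t' (\<lambda>k. w k - c' * vec t' k)"
    using cell_unique[of t t' c w c'] that by (simp add: cell_def)
qed

end

section \<open>Order complexes as fans\<close>

context level_fan
begin

text \<open>For \<open>r < fst v\<close> the set \<open>bd v\<close> is not a linear subspace; projecting along \<open>vec v\<close> flattens its two
  halves into one.\<close>

definition proj :: "nat \<times> int \<Rightarrow> (int \<Rightarrow> real) \<Rightarrow> int \<Rightarrow> real" where
  "proj = (\<lambda>(i, m) w k. if r < i \<and> k = m - 1 then w k - (2 * real (i - Suc r) + 1) * w m else w k)"

lemma proj_sum: "(\<Sum>t\<in>S. f t * proj v (p t) k) = proj v (\<lambda>k. \<Sum>t\<in>S. f t * p t k) k"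
proof -
  have "(\<Sum>t\<in>S. f t * (p t a - c * p t e)) = (\<Sum>t\<in>S. f t * p t a) - c * (\<Sum>t\<in>S. f t * p t e)"
    for a e :: int and c :: real
    by (simp add: right_diff_distrib sum_subtractf sum_distrib_left mult.left_commute)
  then show ?thesis by (auto simp: proj_def split: prod.splits)
qed

text \<open>If \<open>i \<le> r\<close> or the level is \<open>b\<close>, \<open>bd v\<close> is a
  coordinate subspace and \<open>proj v\<close> is the identity on the tested coordinates. Otherwise
  \<open>bd v\<close> is two half-spaces with a common boundary, and by \<open>ray_diff\<close> the
  sign of \<open>u (m - 1)\<close> selects the half.\<close>

lemma proj_bij:
  assumes "v \<in> V"
  shows "\<exists>!w. bd v w \<and> (\<forall>k\<in>{b..snd v - 1}. proj v w k = u k)"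
proof -
  obtain i m where v: "v = (i, m)" by fastforce
  have vV: "i \<le> 2 * r + 1" "b \<le> m" using assms v by (auto simp: V_def)
  have sv: "snd v = m" by (simp add: v)
  consider "i \<le> r \<or> m = b" | "r < i" "b < m" using vV by linarith
  then show ?thesis
  proof cases
    case 1
    then have bd: "bd v w \<longleftrightarrow> supp (m - 1) w" for w by (auto simp: v bd_def)
    have proj: "proj v w k = w k" if "k \<in> {b..m - 1}" for w k
      using 1 that by (auto simp: v proj_def)
    show ?thesis
    proof (rule ex1I[of _ "\<lambda>k. if k \<in> {b..m - 1} then u k else 0"])
      fix w assume w: "bd v w \<and> (\<forall>k\<in>{b..snd v - 1}. proj v w k = u k)"
      show "w = (\<lambda>k. if k \<in> {b..m - 1} then u k else 0)"
      proof
        fix k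
        have "w k = 0" if "k \<notin> {b..m - 1}"
          using w that by (auto simp: bd supp_def)
        then show "w k = (if k \<in> {b..m - 1} then u k else 0)"
          using w proj[of k w] by (auto simp: sv)
      qed
    qed (auto simp: bd supp_def proj sv)
  next
    case 2
    define j where "j = i - Suc r"
    have j: "j \<le> r" using vV 2 by (simp add: j_def)
    have bd: "bd v w \<longleftrightarrow> supp m w \<and> (\<exists>p\<in>{j, Suc j}. \<exists>a\<ge>0.
        w (m - 1) = a * ray_x r p \<and> w m = a * ray_y r p)" for w
      using 2 by (simp add: v bd_def j_def)
    have proj: "proj v w k = (if k = m - 1 then w k - (2 * real j + 1) * w m else w k)" for w k
      using 2 by (simp add: v proj_def j_def)
    have diff: "a * ray_x r p - (2 * real j + 1) * (a * ray_y r p) = (if p = j then -a else a)"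
      if "p \<in> {j, Suc j}" for p a
    proof -
      have "a * ray_x r p - (2 * real j + 1) * (a * ray_y r p) =
          a * (ray_x r p - (2 * real j + 1) * ray_y r p)" by (simp add: algebra_simps)
      then show ?thesis using ray_diff[OF j] that by auto
    qed
    define p where "p = (if u (m - 1) \<le> 0 then j else Suc j)"
    define a where "a = \<bar>u (m - 1)\<bar>"
    have p: "p \<in> {j, Suc j}" by (simp add: p_def)
    have "(if p = j then -a else a) = u (m - 1)" by (auto simp: p_def a_def)
    then have pa: "a * ray_x r p - (2 * real j + 1) * (a * ray_y r p) = u (m - 1)"
      using diff[OF p, of a] by simp
    define w0 where "w0 k = (if k = m then a * ray_y r p else if k = m - 1 then a * ray_x r p
      else if k \<in> {b..m - 1} then u k else 0)" for k
    show ?thesis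
    proof (rule ex1I[of _ w0])
      have "bd v w0" unfolding bd
      proof (intro conjI bexI[OF _ p] exI[of _ a])
        show "supp m w0" using 2 by (auto simp: supp_def w0_def)
      qed (auto simp: w0_def a_def)
      then show "bd v w0 \<and> (\<forall>k\<in>{b..snd v - 1}. proj v w0 k = u k)"
        using pa by (auto simp: proj sv w0_def)
    next
      fix w assume w: "bd v w \<and> (\<forall>k\<in>{b..snd v - 1}. proj v w k = u k)"
      then obtain p' a' where p': "p' \<in> {j, Suc j}" "a' \<ge> 0" "w (m - 1) = a' * ray_x r p'" "w m = a' * ray_y r p'"
        and sw: "supp m w" unfolding bd by blast
      have "proj v w (m - 1) = u (m - 1)" using w 2 by (auto simp: sv)
      then have "(if p' = j then -a' else a') = u (m - 1)"
        using diff[OF p'(1), of a'] p' by (simp add: proj)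
      \<comment> \<open>Points with \<open>a = 0\<close> lie in both halves, so the ray index is
        determined only for nonzero \<open>a\<close>.\<close>
      then have "a' = a" "a \<noteq> 0 \<Longrightarrow> p' = p"
        using p' by (auto simp: a_def p_def split: if_splits)
      then have top: "w (m - 1) = w0 (m - 1)" "w m = w0 m"
        using p' by (auto simp: w0_def)
      show "w = w0"
      proof
        fix k
        consider "k = m" | "k = m - 1" | "k < b \<or> m < k" | "b \<le> k" "k < m - 1" by linarith
        then show "w k = w0 k"
        proof cases
          case 3
          then show ?thesis using sw 2 by (auto simp: supp_def w0_def)
        next
          case 4
          then have "proj v w k = u k" using w by (auto simp: sv)
          with 4 show ?thesis by (auto simp: proj w0_def)
        qed (use top in auto)
      qed
    qed
  qed
qed

text \<open>Chains below \<open>v\<close> represent exactly the vectors of \<open>bd v\<close>, each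
  once, and \<open>proj v\<close> carries \<open>bd v\<close> bijectively onto the whole coordinate
  space.\<close>

lemma complete_fan_V:
  assumes v: "v \<in> V"
  shows "complete_fan {C. finite C \<and> (\<forall>s\<in>C. \<forall>t\<in>C. s = t \<or> below r s t \<or> below r t s) \<and>
      (\<forall>t\<in>C. t \<in> V \<and> below r t v)} (\<lambda>t. proj v (vec t)) {b..snd v - 1}"
    (is "complete_fan ?K ?q ?I")
  unfolding complete_fan_def
proof
  fix u
  have rep_iff: "fan_rep ?K ?q ?I u f \<longleftrightarrow> (\<exists>w. rep v w f \<and> (\<forall>k\<in>?I. proj v w k = u k))" for f
    unfolding fan_rep_def rep_def proj_sum by auto
  obtain w where w: "bd v w" "\<forall>k\<in>?I. proj v w k = u k"
    and uniq: "\<And>w'. bd v w' \<Longrightarrow> \<forall>k\<in>?I. proj v w' k = u k \<Longrightarrow> w' = w"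
    using proj_bij[OF v, of u] by blast
  obtain f where f: "rep v w f" using rep_exists[OF w(1) v] by blast
  show "\<exists>!f. fan_rep ?K ?q ?I u f"
  proof (rule ex1I[of _ f])
    show "fan_rep ?K ?q ?I u f" using f w(2) rep_iff by blast
    fix g assume "fan_rep ?K ?q ?I u g"
    then obtain w' where w': "rep v w' g" "\<forall>k\<in>?I. proj v w' k = u k" using rep_iff by blast
    then have "w' = w" using uniq rep_imp_bd v by blast
    then show "g = f" using w'(1) f rep_unique v by blast
  qed
qed

end

text \<open>Join of \<open>K\<close> with the two-point complex on \<open>a\<close> and \<open>a'\<close>.\<close>

definition join_points :: "'a \<Rightarrow> 'a \<Rightarrow> 'a set set \<Rightarrow> 'a set set" where
  "join_points a a' K = {F. F - {a, a'} \<in> K \<and> \<not> {a, a'} \<subseteq> F}"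

text \<open>The points \<open>a\<close> and \<open>a'\<close> get opposite unit vectors in the new
  coordinate \<open>i0\<close>. A face contains at most one of them, so their coefficients must be
  the positive and negative parts of \<open>u i0\<close>.\<close>

lemma complete_fan_join_points:
  assumes fan: "complete_fan K p I" and "a \<noteq> a'" "a \<notin> \<Union>K" "a' \<notin> \<Union>K" "i0 \<notin> I"
    and fin: "\<And>F. F \<in> K \<Longrightarrow> finite F"
  shows "complete_fan (join_points a a' K)
    (\<lambda>v i. if v = a then if i = i0 then 1 else 0
           else if v = a' then if i = i0 then -1 else 0
           else if i = i0 then 0 else p v i) (insert i0 I)"
    (is "complete_fan ?K ?p ?I")
  unfolding complete_fan_def
proof
  fix u
  have rep_iff: "fan_rep ?K ?p ?I u f \<longleftrightarrow>
      fan_rep K p I u (f(a := 0, a' := 0)) \<and> f a = max (u i0) 0 \<and> f a' = max (- u i0) 0" for f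
  proof -
    let ?g = "f(a := 0, a' := 0)"
    let ?S = "{v. f v \<noteq> 0}" and ?T = "{v. ?g v \<noteq> 0}"
    have T: "?T = ?S - {a, a'}" by auto
    show ?thesis
    proof (cases "?T \<in> K")
      case True
      then have finT: "finite ?T" by (rule fin)
      have S: "?S \<subseteq> ?T \<union> {a, a'}" by auto
      have sum: "(\<Sum>v\<in>?S. f v * ?p v i) = (\<Sum>v\<in>?T. f v * ?p v i) + (f a * ?p a i + f a' * ?p a' i)" for i
      proof -
        have "(\<Sum>v\<in>?S. f v * ?p v i) = (\<Sum>v\<in>?T \<union> {a, a'}. f v * ?p v i)"
          using S finT by (intro sum.mono_neutral_left) auto
        also have "\<dots> = (\<Sum>v\<in>?T. f v * ?p v i) + (\<Sum>v\<in>{a, a'}. f v * ?p v i)"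
          using finT by (intro sum.union_disjoint) auto
        finally show ?thesis using assms(2) by simp
      qed
      have sumI: "(\<Sum>v\<in>?S. f v * ?p v i) = (\<Sum>v\<in>?T. ?g v * p v i)" if "i \<in> I" for i
      proof -
        have "i \<noteq> i0" using that assms(5) by auto
        then show ?thesis unfolding sum by (auto intro!: sum.cong)
      qed
      have sum0: "(\<Sum>v\<in>?S. f v * ?p v i0) = f a - f a'"
      proof -
        have "(\<Sum>v\<in>?T. f v * ?p v i0) = 0" by (intro sum.neutral) auto
        then show ?thesis using assms(2) unfolding sum by simp
      qed
      have "?S \<in> ?K \<longleftrightarrow> \<not> (f a \<noteq> 0 \<and> f a' \<noteq> 0)"
        using True unfolding T join_points_def by auto
      then have "fan_rep ?K ?p ?I u f \<longleftrightarrow> (\<forall>v. 0 \<le> f v) \<and> (f a = 0 \<or> f a' = 0) \<and>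
          f a - f a' = u i0 \<and> (\<forall>i\<in>I. (\<Sum>v\<in>?T. ?g v * p v i) = u i)"
        using sumI sum0 unfolding fan_rep_def by auto
      moreover have "fan_rep K p I u ?g \<longleftrightarrow>
          (\<forall>v. 0 \<le> ?g v) \<and> (\<forall>i\<in>I. (\<Sum>v\<in>?T. ?g v * p v i) = u i)"
        using True unfolding fan_rep_def by blast
      moreover have "(\<forall>v. 0 \<le> f v) \<longleftrightarrow> (\<forall>v. 0 \<le> ?g v) \<and> 0 \<le> f a \<and> 0 \<le> f a'" by auto
      moreover have "0 \<le> f a \<and> 0 \<le> f a' \<and> (f a = 0 \<or> f a' = 0) \<and> f a - f a' = u i0 \<longleftrightarrow>
          f a = max (u i0) 0 \<and> f a' = max (- u i0) 0" by (auto simp: max_def)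
      ultimately show ?thesis by blast
    next
      case False
      then have "?S \<notin> ?K" unfolding T by (simp add: join_points_def)
      with False show ?thesis by (auto simp: fan_rep_def)
    qed
  qed
  obtain g where g: "fan_rep K p I u g" and uniq: "\<And>h. fan_rep K p I u h \<Longrightarrow> h = g"
    using fan unfolding complete_fan_def by blast
  have "g a = 0" "g a' = 0" using g assms(3,4) unfolding fan_rep_def by auto
  then have g0: "g(a := 0, a' := 0) = g" by auto
  show "\<exists>!f. fan_rep ?K ?p ?I u f"
  proof (rule ex1I[of _ "g(a := max (u i0) 0, a' := max (- u i0) 0)"])
    have "(g(a := max (u i0) 0, a' := max (- u i0) 0))(a := 0, a' := 0) = g"
      using g0 by (metis fun_upd_twist fun_upd_upd)
    then show "fan_rep ?K ?p ?I u (g(a := max (u i0) 0, a' := max (- u i0) 0))"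
      using g assms(2) unfolding rep_iff by simp
    fix f assume "fan_rep ?K ?p ?I u f"
    then have f: "f(a := 0, a' := 0) = g" "f a = max (u i0) 0" "f a' = max (- u i0) 0"
      using uniq unfolding rep_iff by blast+
    show "f = g(a := max (u i0) 0, a' := max (- u i0) 0)"
      unfolding f(1)[symmetric] using f(2,3) by auto
  qed
qed

section \<open>Fans for the intervals of the level poset\<close>

lemma order_complex_fan:
  fixes s :: int
  assumes "i = 0 \<or> r < i" and lt: "below r (i, s) y"
  shows "\<exists>p. complete_fan (order_complex (level_order (matrix_M r)) (i, s) y) p {s + 1..snd y - 1}"
proof -
  \<comment> \<open>The successors of \<open>i\<close> are all indices up to \<open>r\<close> and
    exactly one larger index, which depends on the row type.\<close>
  define d where "d = (if i = 0 then r + 1 else 2 * r + 1)"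
  interpret level_fan r d "s + 1" by standard (simp add: d_def)
  have V: "below r (i, s) t \<longleftrightarrow> t \<in> V" for t
  proof -
    have i: "i \<le> 2 * r + 1" using lt by (simp add: below_def)
    obtain j k where t: "t = (j, k)" by fastforce
    have "t \<in> V \<longleftrightarrow> j \<le> 2 * r + 1 \<and> s + 1 \<le> k \<and> (k = s + 1 \<longrightarrow> j \<le> r \<or> j = d)"
      by (simp add: V_def t)
    moreover have "below r (i, s) t \<longleftrightarrow> j \<le> 2 * r + 1 \<and> s + 1 \<le> k \<and> (k = s + 1 \<longrightarrow> edge r i j)"
      using assms(1) i by (auto simp: below_def t edge_def)
    moreover have "edge r i j \<longleftrightarrow> j \<le> 2 * r + 1 \<and> (j \<le> r \<or> j = d)"
      using assms(1) i by (auto simp: edge_def d_def)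
    ultimately show ?thesis by auto
  qed
  have fst: "fst (i, s) \<le> 2 * r + 1" "fst y \<le> 2 * r + 1" using lt by (simp_all add: below_def)
  have "order_complex (level_order (matrix_M r)) (i, s) y =
     {C. finite C \<and> (\<forall>s\<in>C. \<forall>t\<in>C. s = t \<or> below r s t \<or> below r t s) \<and>
      (\<forall>t\<in>C. t \<in> V \<and> below r t y)}"
    by (rule Set.set_eqI) (simp only: order_complex_iff[OF fst] V mem_Collect_eq)
  then show ?thesis using complete_fan_V[of y] V[of y] lt by auto
qed

text \<open>Everything else above \<open>x\<close> lies above both of the incomparable
  \<open>a\<close> and \<open>a'\<close>, so a chain of the interval is a chain above
  \<open>z\<close> extended by at most one of them. The element \<open>z\<close> just describes this
  upper part and may lie outside the interval.\<close>

lemma order_complex_join: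
  assumes x: "fst x \<le> 2 * r + 1" and z: "fst z \<le> 2 * r + 1" and y: "fst y \<le> 2 * r + 1"
    and up: "\<And>t. below r x t \<Longrightarrow> t = a \<or> t = a' \<or> below r z t"
    and low: "below r x a" "below r x a'"
    and down: "\<And>t. below r z t \<Longrightarrow> below r x t \<and> below r a t \<and> below r a' t"
    and ne: "a \<noteq> a'" "\<not> below r a a'" "\<not> below r a' a"
    and zy: "below r z y"
  shows "order_complex (level_order (matrix_M r)) x y =
    join_points a a' (order_complex (level_order (matrix_M r)) z y)"
proof (rule Set.set_eqI)
  fix C
  let ?chain = "\<lambda>C. \<forall>s\<in>C. \<forall>t\<in>C. s = t \<or> below r s t \<or> below r t s"
  have "finite C \<and> ?chain C \<and> (\<forall>t\<in>C. below r x t \<and> below r t y) \<longleftrightarrow>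
      (finite (C - {a, a'}) \<and> ?chain (C - {a, a'}) \<and>
      (\<forall>t\<in>C - {a, a'}. below r z t \<and> below r t y)) \<and> \<not> {a, a'} \<subseteq> C" (is "?L \<longleftrightarrow> ?R")
  proof
    assume L: ?L
    then have "finite C" and chain: "?chain C" and C: "\<forall>t\<in>C. below r x t \<and> below r t y" by simp_all
    have "\<not> {a, a'} \<subseteq> C"
    proof
      assume "{a, a'} \<subseteq> C"
      then have "a \<in> C" "a' \<in> C" by simp_all
      then show False using chain ne by metis
    qed
    moreover have "below r z t \<and> below r t y" if "t \<in> C - {a, a'}" for t
      using C up[of t] that by auto
    moreover have "?chain (C - {a, a'})" using chain by simp
    ultimately show ?R using \<open>finite C\<close> by simp
  next
    assume R: ?R
    then have "finite C" and chain: "?chain (C - {a, a'})" and aa: "\<not> {a, a'} \<subseteq> C"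
      and C: "\<And>t. t \<in> C - {a, a'} \<Longrightarrow> below r z t \<and> below r t y" by simp_all
    have "below r x t \<and> below r t y" if "t \<in> C" for t
      using C[of t] that down[of t] down[of y] low zy by (cases "t \<in> {a, a'}") auto
    moreover have "s = t \<or> below r s t \<or> below r t s" if "s \<in> C" "t \<in> C" for s t
    proof -
      consider "s \<in> {a, a'}" "t \<in> {a, a'}" | "s \<in> {a, a'}" "t \<notin> {a, a'}"
        | "s \<notin> {a, a'}" "t \<in> {a, a'}" | "s \<notin> {a, a'}" "t \<notin> {a, a'}" by blast
      then show ?thesis
      proof cases
        case 1
        then show ?thesis using aa that by auto
      next
        case 2
        then have "below r z t" using C that by blast
        then show ?thesis using down[of t] 2 by auto
      next
        case 3
        then have "below r z s" using C that by blast
        then show ?thesis using down[of s] 3 by auto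
      next
        case 4
        then show ?thesis using chain that by simp
      qed
    qed
    ultimately show ?L using \<open>finite C\<close> by blast
  qed
  then show "C \<in> order_complex (level_order (matrix_M r)) x y \<longleftrightarrow>
      C \<in> join_points a a' (order_complex (level_order (matrix_M r)) z y)"
    unfolding join_points_def mem_Collect_eq order_complex_iff[OF x y] order_complex_iff[OF z y]
    by (simp only:)
qed

text \<open>From level \<open>s + 2\<close> on, \<open>(i, s)\<close> and
  \<open>(2 * r + 1, s + 1)\<close> have the same elements above them, so the latter serves as
  \<open>z\<close>, although it is above \<open>(i, s)\<close> only for
  \<open>i = r\<close>.\<close>

lemma order_complex_middle:
  assumes i: "1 \<le> i" "i \<le> r" and lt: "below r (i, s) y" "snd y \<ge> s + 2"
  shows "below r (2 * r + 1, s + 1) y"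
    "order_complex (level_order (matrix_M r)) (i, s) y =
       join_points (r + i, s + 1) (r + i + 1, s + 1)
         (order_complex (level_order (matrix_M r)) (2 * r + 1, s + 1) y)"
proof -
  have up: "t = (r + i, s + 1) \<or> t = (r + i + 1, s + 1) \<or> below r (2 * r + 1, s + 1) t"
    if "below r (i, s) t" for t
    using that i by (cases t) (auto simp: below_def edge_def)
  have down: "below r (i, s) t \<and> below r (r + i, s + 1) t \<and> below r (r + i + 1, s + 1) t"
    if "below r (2 * r + 1, s + 1) t" for t
    using that i by (cases t) (auto simp: below_def edge_def)
  show xy: "below r (2 * r + 1, s + 1) y" using up[OF lt(1)] lt(2) by auto
  show "order_complex (level_order (matrix_M r)) (i, s) y =
       join_points (r + i, s + 1) (r + i + 1, s + 1)
         (order_complex (level_order (matrix_M r)) (2 * r + 1, s + 1) y)"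
    by (rule order_complex_join[OF _ _ _ up _ _ down _ _ _ xy])
       (use i lt in \<open>auto simp: below_def edge_def\<close>)
qed

theorem corollary6p4:
  fixes r :: nat and x y :: "nat \<times> int"
  assumes "(x, y) \<in> level_order (matrix_M r)" and "x \<noteq> y"
  shows "homeomorphic_to_sphere
           (geometric_realization (order_complex (level_order (matrix_M r)) x y))"
proof -
  let ?K = "order_complex (level_order (matrix_M r)) x y"
  obtain i s where x: "x = (i, s)" by fastforce
  have lt: "below r (i, s) y" and i: "fst x \<le> 2 * r + 1" and y: "fst y \<le> 2 * r + 1"
    using assms x by (auto simp: level_order_iff)
  note K_iff = order_complex_iff[OF i y]
  have sub: "C \<subseteq> {..2 * r + 1} \<times> {s<..<snd y}" if "C \<in> ?K" for C
  proof
    fix t assume "t \<in> C"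
    then have t: "below r x t" "below r t y" using that K_iff by blast+
    then have "fst t \<le> 2 * r + 1" by (simp add: below_def)
    then show "t \<in> {..2 * r + 1} \<times> {s<..<snd y}"
      using t[THEN below_less] x by (cases t) auto
  qed
  have finK: "finite ?K"
    by (rule finite_subset[of _ "Pow ({..2 * r + 1} \<times> {s<..<snd y})"]) (use sub in auto)
  have fin: "finite F" if "F \<in> ?K" for F using that K_iff by blast
  have down: "G \<in> ?K" if "F \<in> ?K" "G \<subseteq> F" for F G
  proof -
    have F: "finite F" "\<forall>s\<in>F. \<forall>t\<in>F. s = t \<or> below r s t \<or> below r t s"
      "\<forall>t\<in>F. below r x t \<and> below r t y"
      using that(1) unfolding K_iff by simp_all
    show ?thesis
      unfolding K_iff using that(2) F finite_subset[OF that(2)] by (intro conjI ballI) (simp_all add: subsetD)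
  qed
  have "\<exists>p I. complete_fan ?K p I \<and> finite (I :: int set)"
  proof (cases "i = 0 \<or> r < i")
    case True
    then obtain p where "complete_fan ?K p {s + 1..snd y - 1}"
      using order_complex_fan[OF True lt] x by blast
    then show ?thesis by (intro exI[of _ p] exI[of _ "{s + 1..snd y - 1}"]) simp
  next
    case False
    then have i: "1 \<le> i" "i \<le> r" by auto
    show ?thesis
    proof (cases "snd y \<ge> s + 2")
      case True
      let ?x = "(2 * r + 1, s + 1)"
      let ?K' = "order_complex (level_order (matrix_M r)) ?x y"
      note join = order_complex_middle[OF i lt True]
      obtain p where p: "complete_fan ?K' p {s + 1 + 1..snd y - 1}"
        using order_complex_fan[OF _ join(1)] by auto
      have K': "finite F \<and> (r + i, s + 1) \<notin> F \<and> (r + i + 1, s + 1) \<notin> F" if "F \<in> ?K'" for F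
      proof -
        have "finite F" "\<forall>t\<in>F. below r ?x t"
          using that order_complex_iff[of ?x r y F] y by auto
        moreover from this have "\<forall>t\<in>F. s + 1 < snd t" using below_less[of r ?x] by auto
        ultimately show ?thesis by auto
      qed
      \<comment> \<open>The suspension uses coordinate \<open>s + 1\<close>, which the fan of the
        upper part, starting at \<open>s + 2\<close>, leaves free.\<close>
      have "\<exists>p. complete_fan ?K p (insert (s + 1) {s + 1 + 1..snd y - 1})"
        unfolding x join(2)
        by (rule exI, rule complete_fan_join_points[OF p]) (use K' in auto)
      then show ?thesis by (meson finite_insert finite_atLeastAtMost_int)
    next
      case False
      \<comment> \<open>Here \<open>y\<close> covers \<open>x\<close>: only the empty face remains,
        a complete fan in no coordinates, whose realization is the sphere of dimension -1.\<close>
      then have "{s<..<snd y} = {}" by auto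
      then have "C = {}" if "C \<in> ?K" for C using sub[OF that] by auto
      moreover have "{} \<in> ?K" unfolding K_iff by simp
      ultimately have "?K = {{}}" by auto
      moreover have "fan_rep {{}} (\<lambda>v k. 0) {} u f \<longleftrightarrow> f = (\<lambda>v. 0)" for u :: "int \<Rightarrow> real" and f :: "nat \<times> int \<Rightarrow> real"
        by (auto simp: fan_rep_def)
      then have "complete_fan {{} :: (nat \<times> int) set} (\<lambda>v k :: int. 0) {}"
        by (simp add: complete_fan_def)
      ultimately show ?thesis by auto
    qed
  qed
  then obtain p and I :: "int set" where "complete_fan ?K p I" "finite I" by blast
  then show ?thesis using finK fin down by (rule complete_fan_sphere)
qed

end
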